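(* Let $C\subset\mathbb{P}^n$ be a rational normal curve of degree $r\le n$, let $a\ge 0$, and let $X$ be the doubling of $C$ defined by a surjective map $\mu:\mathcal{O}_{\mathbb{P}^1}^{r-1}(-r-2)\oplus\mathcal{O}_{\mathbb{P}^1}^{n-r}(-r)\to\mathcal{O}_{\mathbb{P}^1}(-r-2+a)$. Then the Hilbert polynomial of $X$ is $P_X(t)=2rt+a-r$, and so its arithmetic genus is $g_X=r+1-a$.
   Context: $K$ is an algebraically closed field of characteristic $0$ and $\mathbb{P}^n=\mathbb{P}^n_K$. A rational normal curve of degree $r$ in $\mathbb{P}^n$ ($r\le n$) is the image of the degree $r$ Veronese embedding $\mathbb{P}^1\to\mathbb{P}^r$ followed by a linear embedding $\mathbb{P}^r\to\mathbb{P}^n$. Let $C$ be such a curve, with ideal sheaf $\mathcal{I}_C$ and a fixed isomorphism $j:\mathbb{P}^1\to C$. One has $j^*(\mathcal{I}_C/\mathcal{I}_C^2)\cong\mathcal{O}_{\mathbb{P}^1}^{r-1}(-r-2)\oplus\mathcal{O}_{\mathbb{P}^1}^{n-r}(-r)$. A surjective map $\mu$ from this sheaf to $\mathcal{O}_{\mathbb{P}^1}(-r-2+a)$ corresponds to a surjection $\mathcal{I}_C/\mathcal{I}_C^2\to\mathcal{L}$ with $\mathcal{L}=j_*\mathcal{O}_{\mathbb{P}^1}(-r-2+a)$; the doubling $X$ of $C$ defined by $\mu$ is the curve with ideal sheaf $\mathcal{I}_X$, $\mathcal{I}_C^2\subseteq\mathcal{I}_X\subseteq\mathcal{I}_C$,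 such that $\mathcal{I}_X/\mathcal{I}_C^2$ is the kernel of this surjection. The arithmetic genus $g$ of a curve $X$ of degree $d$ is defined by $P_X(t)=dt+1-g$. *)

theory Defs
  imports Complex_Main "HOL-Computational_Algebra.Polynomial" "HOL-Library.Function_Algebras"
begin

section \<open>Forms, projective space and its Zariski topology\<close>

text \<open>
  Throughout, the ground field is an algebraically closed (hence infinite) field, so a
  form in x_0, ..., x_n is identified with the polynomial function that it induces, and a projective
  scheme of finite type is described on its closed points.
  A subset of n-dimensional projective space is represented by its affine cone
  without the origin, i.e. by its preimage in the set of nonzero vectors (x_0, ..., x_n).
  Vectors are functions on the naturals vanishing beyond n.  Addition, multiplication
  and zero of functions are the pointwise ones of \<^theory>\<open>HOL-Library.Function_Algebras\<close>.
\<close>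

type_synonym 'k pt = "nat \<Rightarrow> 'k"
type_synonym 'k fn = "'k pt \<Rightarrow> 'k"

definition vecs :: "nat \<Rightarrow> 'k::field pt set" where
  "vecs n = {x. \<forall>i>n. x i = 0}"

definition proj :: "nat \<Rightarrow> 'k::field pt set" where
  "proj n = vecs n - {0}"

definition exponents :: "nat \<Rightarrow> nat \<Rightarrow> (nat \<Rightarrow> nat) set" where
  "exponents n d = {\<alpha>. (\<forall>i>n. \<alpha> i = 0) \<and> (\<Sum>i\<le>n. \<alpha> i) = d}"

definition forms :: "nat \<Rightarrow> nat \<Rightarrow> 'k::field fn set" where
  "forms n d = {F. \<exists>c. F = (\<lambda>x. \<Sum>\<alpha>\<in>exponents n d. c \<alpha> * (\<Prod>i\<le>n. x i ^ \<alpha> i))}"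

definition zopen :: "nat \<Rightarrow> 'k::field pt set \<Rightarrow> bool" where
  "zopen n U \<longleftrightarrow> (\<exists>T \<subseteq> (\<Union>d. forms n d). U = {x \<in> proj n. \<exists>F\<in>T. F x \<noteq> 0})"

section \<open>Sheaves of modules\<close>

text \<open>
  A sheaf of modules over the structure sheaf of a projective space: its sections over the
  Zariski open sets, the multiplication by regular functions and the restriction to a smaller
  open set.  The additive structure is that of the type of sections.
\<close>

record ('k, 's) sheaf =
  sections :: "'k pt set \<Rightarrow> 's set"
  scal :: "'k fn \<Rightarrow> 's \<Rightarrow> 's"
  restr :: "'k pt set \<Rightarrow> 's \<Rightarrow> 's"

definition cut :: "'k pt set \<Rightarrow> 'k::field fn \<Rightarrow> 'k fn" where
  "cut U f = (\<lambda>x. if x \<in> U then f x else 0)"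

text \<open>
  Sections of O(m) over U are the functions on the cone over U that are locally quotients
  of forms whose degrees differ by m.  To make them unique as total functions, they are
  extended by zero outside U.
\<close>

definition line_bundle :: "nat \<Rightarrow> int \<Rightarrow> ('k::field, 'k fn) sheaf" where
  "line_bundle n m =
     \<lparr>sections = (\<lambda>U. {f. (\<forall>x. x \<notin> U \<longrightarrow> f x = 0) \<and>
        (\<forall>p\<in>U. \<exists>V d e. \<exists>P\<in>forms n d. \<exists>Q\<in>forms n e.
            zopen n V \<and> p \<in> V \<and> V \<subseteq> U \<and> int d - int e = m \<and>
            (\<forall>x\<in>V. Q x \<noteq> 0 \<and> f x = P x / Q x))}),
      scal = (*),
      restr = cut\<rparr>"

definition line_bundle_sum :: "nat \<Rightarrow> int list \<Rightarrow> ('k::field, nat \<Rightarrow> 'k fn) sheaf" where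
  "line_bundle_sum n ms =
     \<lparr>sections = (\<lambda>U. {s. (\<forall>k<length ms. s k \<in> sections (line_bundle n (ms ! k)) U) \<and>
                          (\<forall>k\<ge>length ms. s k = 0)}),
      scal = (\<lambda>a s k. a * s k),
      restr = (\<lambda>U s k. cut U (s k))\<rparr>"

definition sheaf_hom ::
  "nat \<Rightarrow> ('k::field, 's::ab_group_add) sheaf \<Rightarrow> ('k, 't::ab_group_add) sheaf
     \<Rightarrow> ('k pt set \<Rightarrow> 's \<Rightarrow> 't) \<Rightarrow> bool" where
  "sheaf_hom n F G \<phi> \<longleftrightarrow> (\<forall>U. zopen n U \<longrightarrow>
     (\<forall>s\<in>sections F U. \<phi> U s \<in> sections G U) \<and>
     (\<forall>s\<in>sections F U. \<forall>t\<in>sections F U. \<phi> U (s + t) = \<phi> U s + \<phi> U t) \<and>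
     (\<forall>a\<in>sections (line_bundle n 0) U. \<forall>s\<in>sections F U. \<phi> U (scal F a s) = scal G a (\<phi> U s)) \<and>
     (\<forall>V s. zopen n V \<and> V \<subseteq> U \<and> s \<in> sections F U \<longrightarrow> \<phi> V (restr F V s) = restr G V (\<phi> U s)))"

text \<open>Surjectivity as a map of sheaves: sections of the target lift locally.\<close>

definition sheaf_surj ::
  "nat \<Rightarrow> ('k::field, 's::ab_group_add) sheaf \<Rightarrow> ('k, 't::ab_group_add) sheaf
     \<Rightarrow> ('k pt set \<Rightarrow> 's \<Rightarrow> 't) \<Rightarrow> bool" where
  "sheaf_surj n F G \<phi> \<longleftrightarrow> (\<forall>U t. zopen n U \<and> t \<in> sections G U \<longrightarrow>
     (\<forall>p\<in>U. \<exists>V. zopen n V \<and> p \<in> V \<and> V \<subseteq> U \<and> (\<exists>s\<in>sections F V. \<phi> V s = restr G V t)))"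

definition kernel_sheaf ::
  "('k::field, 's::ab_group_add) sheaf \<Rightarrow> ('k pt set \<Rightarrow> 's \<Rightarrow> 't::ab_group_add)
     \<Rightarrow> ('k, 's) sheaf" where
  "kernel_sheaf F \<phi> = F\<lparr>sections := (\<lambda>U. {s \<in> sections F U. \<phi> U s = 0})\<rparr>"

definition preim :: "('k::field pt \<Rightarrow> 'k pt) \<Rightarrow> 'k pt set \<Rightarrow> 'k pt set" where
  "preim j U = {p \<in> proj 1. j p \<in> U}"

text \<open>
  Direct image under a morphism j defined on the projective line.  The pullback \<open>a \<circ> j\<close> of a regular
  function need not vanish at vectors outside the projective line, but sections of G do, so the
  product is the intended one.
\<close>

definition pushforward ::
  "('k::field pt \<Rightarrow> 'k pt) \<Rightarrow> ('k, 's) sheaf \<Rightarrow> ('k, 's) sheaf" where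
  "pushforward j G =
     \<lparr>sections = (\<lambda>U. sections G (preim j U)),
      scal = (\<lambda>a s. scal G (a \<circ> j) s),
      restr = (\<lambda>U s. restr G (preim j U) s)\<rparr>"

definition pushforward_map ::
  "('k::field pt \<Rightarrow> 'k pt) \<Rightarrow> ('k pt set \<Rightarrow> 's \<Rightarrow> 't) \<Rightarrow> 'k pt set \<Rightarrow> 's \<Rightarrow> 't" where
  "pushforward_map j \<mu> = (\<lambda>U. \<mu> (preim j U))"

definition ideal_sheaf :: "nat \<Rightarrow> 'k::field pt set \<Rightarrow> ('k, 'k fn) sheaf" where
  "ideal_sheaf n C = (line_bundle n 0)
     \<lparr>sections := (\<lambda>U. {f \<in> sections (line_bundle n 0) U. \<forall>x \<in> U \<inter> C. f x = 0})\<rparr>"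

text \<open>The square of an ideal sheaf: sections that are locally finite sums of products.\<close>

definition square_sheaf :: "nat \<Rightarrow> ('k::field, 'k fn) sheaf \<Rightarrow> ('k, 'k fn) sheaf" where
  "square_sheaf n I = I\<lparr>sections := (\<lambda>U. {f \<in> sections (line_bundle n 0) U.
     \<forall>p\<in>U. \<exists>V. zopen n V \<and> p \<in> V \<and> V \<subseteq> U \<and>
       (\<exists>(N::nat) a b. (\<forall>k<N. a k \<in> sections I V \<and> b k \<in> sections I V) \<and>
                       cut V f = (\<Sum>k<N. a k * b k))})\<rparr>"

section \<open>Rational normal curves and their doublings\<close>

definition veronese :: "nat \<Rightarrow> 'k::field pt \<Rightarrow> 'k pt" where
  "veronese r p = (\<lambda>k. if k \<le> r then p 0 ^ (r - k) * p 1 ^ k else 0)"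

definition linear_embedding :: "nat \<Rightarrow> nat \<Rightarrow> ('k::field pt \<Rightarrow> 'k pt) \<Rightarrow> bool" where
  "linear_embedding r n L \<longleftrightarrow>
     (\<forall>x\<in>vecs r. L x \<in> vecs n) \<and>
     (\<forall>x\<in>vecs r. \<forall>y\<in>vecs r. L (x + y) = L x + L y) \<and>
     (\<forall>c. \<forall>x\<in>vecs r. L (\<lambda>i. c * x i) = (\<lambda>i. c * L x i)) \<and>
     inj_on L (vecs r)"

text \<open>
  C is a rational normal curve of degree r and j is the isomorphism from the projective line
  onto it, in homogeneous coordinates.  Since automorphisms of the projective line act linearly
  on forms of degree r, every isomorphism onto C is of this form for a suitable L.
\<close>

definition rational_normal_curve ::
  "nat \<Rightarrow> nat \<Rightarrow> ('k::field pt \<Rightarrow> 'k pt) \<Rightarrow> 'k pt set \<Rightarrow> bool" where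
  "rational_normal_curve n r j C \<longleftrightarrow>
     (\<exists>L. linear_embedding r n L \<and> j = L \<circ> veronese r) \<and>
     C = {x. \<exists>p\<in>proj 1. \<exists>c. c \<noteq> 0 \<and> x = (\<lambda>i. c * j p i)}"

text \<open>
  An isomorphism between the pullback of the conormal sheaf of C and a sheaf E on the projective
  line, given by the corresponding isomorphism between the conormal sheaf and the direct image of E.
  By the universal property of the quotient, this is a surjective map from the ideal sheaf of C
  whose kernel is the square of the ideal sheaf.
\<close>

definition conormal_iso ::
  "nat \<Rightarrow> ('k::field pt \<Rightarrow> 'k pt) \<Rightarrow> 'k pt set \<Rightarrow> ('k, 's::ab_group_add) sheaf
     \<Rightarrow> ('k pt set \<Rightarrow> 'k fn \<Rightarrow> 's) \<Rightarrow> bool" where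
  "conormal_iso n j C E \<theta> \<longleftrightarrow>
     sheaf_hom n (ideal_sheaf n C) (pushforward j E) \<theta> \<and>
     sheaf_surj n (ideal_sheaf n C) (pushforward j E) \<theta> \<and>
     (\<forall>U. zopen n U \<longrightarrow>
        sections (kernel_sheaf (ideal_sheaf n C) \<theta>) U =
        sections (square_sheaf n (ideal_sheaf n C)) U)"

text \<open>
  The ideal sheaf of the doubling of C defined by a surjection \<open>\<mu>\<close> from E to a line bundle: the
  kernel of the map that the ideal sheaf of C induces through its conormal sheaf.
\<close>

definition doubling ::
  "nat \<Rightarrow> ('k::field pt \<Rightarrow> 'k pt) \<Rightarrow> 'k pt set
     \<Rightarrow> ('k pt set \<Rightarrow> 'k fn \<Rightarrow> 's::ab_group_add) \<Rightarrow> ('k pt set \<Rightarrow> 's \<Rightarrow> 'k fn)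
     \<Rightarrow> ('k, 'k fn) sheaf" where
  "doubling n j C \<theta> \<mu> =
     kernel_sheaf (ideal_sheaf n C) (\<lambda>U f. pushforward_map j \<mu> U (\<theta> U f))"

section \<open>Hilbert polynomial and arithmetic genus\<close>

text \<open>
  The degree t part of the saturated homogeneous ideal of the closed subscheme with ideal sheaf I:
  the forms whose dehomogenizations in all standard charts are sections of I.
\<close>

definition homog_ideal :: "nat \<Rightarrow> ('k::field, 'k fn) sheaf \<Rightarrow> nat \<Rightarrow> 'k fn set" where
  "homog_ideal n I t = {F \<in> forms n t. \<forall>i\<le>n.
     cut {x \<in> proj n. x i \<noteq> 0} (\<lambda>x. F x / x i ^ t) \<in> sections I {x \<in> proj n. x i \<noteq> 0}}"

abbreviation fn_dim :: "'k::field fn set \<Rightarrow> nat" where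
  "fn_dim \<equiv> vector_space.dim (\<lambda>c f x. c * f x)"

text \<open>
  The Hilbert polynomial of the closed subscheme with ideal sheaf I agrees, in large degrees, with
  the Hilbert function of its homogeneous coordinate ring.
\<close>

definition has_hilbert_polynomial ::
  "nat \<Rightarrow> ('k::field, 'k fn) sheaf \<Rightarrow> rat poly \<Rightarrow> bool" where
  "has_hilbert_polynomial n I P \<longleftrightarrow> (\<exists>t0. \<forall>t\<ge>t0.
     of_nat (fn_dim (forms n t :: 'k fn set)) - of_nat (fn_dim (homog_ideal n I t))
       = poly P (of_nat t))"

definition arithmetic_genus :: "nat \<Rightarrow> ('k::field, 'k fn) sheaf \<Rightarrow> int" where
  "arithmetic_genus n I =
     (THE g. \<exists>d::nat. has_hilbert_polynomial n I [:1 - of_int g, of_nat d:])"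

end

theory Submission
  imports Defs
begin

text \<open>
  Put m = a - r - 2.  Composing the conormal isomorphism with \<open>\<mu>\<close> gives a locally surjective map
  \<open>\<phi>\<close> from the ideal sheaf of C to the direct image of O(m), and the ideal sheaf of X is its kernel.
  On forms of degree t vanishing on C it induces, by gluing the images of the dehomogenizations, a
  linear map to the global sections of O(m + r t) on the projective line, i.e. to binary forms of
  that degree, whose kernel is the degree t part of the ideal of X.  For varying t its image is a
  graded module over the ring generated by binary forms of degree r; local surjectivity means that its members
  have no common zero, so it contains powers of both variables and hence all forms of large degree.
  This replaces the vanishing of the first cohomology of the kernel.  Restriction of forms to
  C has image of dimension r t + 1, so the Hilbert function is
  (r t + 1) + (m + r t + 1) = 2 r t + a - r for large t.
\<close>

section \<open>Forms\<close>

text \<open>Two obstacles shape the details. Local surjectivity says nothing directly about global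
  sections, and forms on projective space restrict only to binary forms of degree divisible by
  \<open>r\<close>, so the image is a module over a Veronese subring and not over the full ring of
  binary forms. Setting one variable to 1 removes the second obstacle:
  \<open>x i ^ (r - 1) * x (1 - i)\<close> has degree \<open>r\<close> and still dehomogenizes to
  the affine coordinate, so the dehomogenized members form an honest ideal of univariate
  polynomials. The resulting \<open>graded_module_contains_power\<close> serves twice: with
  \<open>r = 1\<close> for the denominators of a global section of O(d), which identifies such
  sections with binary forms, and with the degree of the curve for the image module. Common zeros
  are excluded by the same device both times: a fraction valid on an open set becomes a global
  relation between forms after multiplication by a form vanishing outside that set. The summands
  \<open>r t + 1\<close> and \<open>m + r t + 1\<close> are numbers of binary monomials; each enters
  through one application of rank-nullity.\<close>

lemma sum_fun_apply: "(\<Sum>i\<in>A. f i) x = (\<Sum>i\<in>A. f i x)"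
  for f :: "'a \<Rightarrow> 'b \<Rightarrow> 'c::comm_monoid_add"
  by (induction A rule: infinite_finite_induct) auto

lemma finite_exponents: "finite (exponents n d)"
proof -
  have "exponents n d \<subseteq> {\<alpha>. \<forall>i. (i \<in> {..n} \<longrightarrow> \<alpha> i \<in> {..d}) \<and> (i \<notin> {..n} \<longrightarrow> \<alpha> i = 0)}"
    by (auto simp: exponents_def intro: member_le_sum)
  then show ?thesis
    by (rule finite_subset) (intro finite_set_of_finite_funs; simp)
qed

lemma forms_zero: "(\<lambda>x. 0) \<in> forms n d"
  unfolding forms_def by (auto intro!: exI[of _ "\<lambda>_. 0"])

lemma forms_add: "F \<in> forms n d \<Longrightarrow> G \<in> forms n d \<Longrightarrow> (\<lambda>x. F x + G x) \<in> forms n d"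
  unfolding forms_def
proof clarify
  fix c c' :: "(nat \<Rightarrow> nat) \<Rightarrow> 'a"
  show "\<exists>c''. (\<lambda>x. (\<Sum>\<alpha>\<in>exponents n d. c \<alpha> * (\<Prod>i\<le>n. x i ^ \<alpha> i)) +
      (\<Sum>\<alpha>\<in>exponents n d. c' \<alpha> * (\<Prod>i\<le>n. x i ^ \<alpha> i))) =
      (\<lambda>x. \<Sum>\<alpha>\<in>exponents n d. c'' \<alpha> * (\<Prod>i\<le>n. x i ^ \<alpha> i))"
    by (rule exI[of _ "\<lambda>\<alpha>. c \<alpha> + c' \<alpha>"]) (simp add: sum.distrib algebra_simps)
qed

lemma forms_cmult: "F \<in> forms n d \<Longrightarrow> (\<lambda>x. c * F x) \<in> forms n d"
  unfolding forms_def
proof clarify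
  fix c' :: "(nat \<Rightarrow> nat) \<Rightarrow> 'a"
  show "\<exists>c''. (\<lambda>x. c * (\<Sum>\<alpha>\<in>exponents n d. c' \<alpha> * (\<Prod>i\<le>n. x i ^ \<alpha> i))) =
      (\<lambda>x. \<Sum>\<alpha>\<in>exponents n d. c'' \<alpha> * (\<Prod>i\<le>n. x i ^ \<alpha> i))"
    by (rule exI[of _ "\<lambda>\<alpha>. c * c' \<alpha>"]) (simp add: sum_distrib_left algebra_simps)
qed

lemma forms_sum: "(\<And>i. i \<in> I \<Longrightarrow> f i \<in> forms n d) \<Longrightarrow> (\<lambda>x. \<Sum>i\<in>I. f i x) \<in> forms n d"
  by (induction I rule: infinite_finite_induct) (auto simp: forms_zero forms_add)

lemma forms_monomial:
  assumes "\<alpha> \<in> exponents n d"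
  shows "(\<lambda>x. \<Prod>i\<le>n. x i ^ \<alpha> i) \<in> forms n d"
proof -
  have "(\<lambda>x::'a pt. \<Prod>i\<le>n. x i ^ \<alpha> i) =
      (\<lambda>x. \<Sum>\<beta>\<in>exponents n d. (if \<beta> = \<alpha> then 1 else 0) * (\<Prod>i\<le>n. x i ^ \<beta> i))"
    using assms finite_exponents[of n d] by (simp add: if_distribR if_distrib cong: if_cong)
  then show ?thesis
    unfolding forms_def mem_Collect_eq by (intro exI[of _ "\<lambda>\<beta>. if \<beta> = \<alpha> then 1 else 0"])
qed

lemma forms_mult:
  assumes "F \<in> forms n d" "G \<in> forms n e"
  shows "(\<lambda>x. F x * G x) \<in> forms n (d + e)"
proof -
  obtain c c' where F: "F = (\<lambda>x. \<Sum>\<alpha>\<in>exponents n d. c \<alpha> * (\<Prod>i\<le>n. x i ^ \<alpha> i))"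
    and G: "G = (\<lambda>x. \<Sum>\<beta>\<in>exponents n e. c' \<beta> * (\<Prod>i\<le>n. x i ^ \<beta> i))"
    using assms unfolding forms_def by blast
  have "(\<lambda>x. (c \<alpha> * c' \<beta>) * (\<Prod>i\<le>n. x i ^ (\<alpha> i + \<beta> i))) \<in> forms n (d + e)"
    if "\<alpha> \<in> exponents n d" "\<beta> \<in> exponents n e" for \<alpha> \<beta>
    using that by (intro forms_cmult forms_monomial) (auto simp: exponents_def sum.distrib)
  then have "(\<lambda>x. \<Sum>\<alpha>\<in>exponents n d. \<Sum>\<beta>\<in>exponents n e.
      (c \<alpha> * c' \<beta>) * (\<Prod>i\<le>n. x i ^ (\<alpha> i + \<beta> i))) \<in> forms n (d + e)"
    by (intro forms_sum)
  then show ?thesis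
    unfolding F G sum_product by (simp add: power_add prod.distrib mult_ac)
qed

lemma forms_const: "(\<lambda>x. c) \<in> forms n 0"
proof -
  have "(\<lambda>x. c * (\<Prod>i\<le>n. x i ^ (0::nat))) \<in> forms n 0"
    by (intro forms_cmult forms_monomial) (simp add: exponents_def)
  then show ?thesis by simp
qed

lemma forms_var:
  assumes "i \<le> n"
  shows "(\<lambda>x. x i) \<in> forms n 1"
proof -
  have "(\<lambda>x::'a pt. \<Prod>k\<le>n. x k ^ (if k = i then 1 else 0)) \<in> forms n 1"
    using assms by (intro forms_monomial) (simp add: exponents_def)
  moreover have "(\<Prod>k\<le>n. x k ^ (if k = i then 1 else 0)) = x i" for x :: "'a pt"
    using assms by (simp add: if_distrib[of "(^) _"] cong: if_cong)
  ultimately show ?thesis by simp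
qed

lemma forms_power: "F \<in> forms n d \<Longrightarrow> (\<lambda>x. F x ^ k) \<in> forms n (k * d)"
  by (induction k) (use forms_const[of 1] forms_mult in auto)

lemma forms_var_power: "i \<le> n \<Longrightarrow> (\<lambda>x. x i ^ k) \<in> forms n k"
  using forms_power[OF forms_var] by fastforce

lemma forms_prod:
  "(\<And>i. i \<in> I \<Longrightarrow> f i \<in> forms n (d i)) \<Longrightarrow> finite I \<Longrightarrow>
     (\<lambda>x. \<Prod>i\<in>I. f i x) \<in> forms n (\<Sum>i\<in>I. d i)"
  by (induction I rule: infinite_finite_induct) (auto simp: forms_const forms_mult)

lemma forms_compose:
  assumes "F \<in> forms n d" "\<And>i. i \<le> n \<Longrightarrow> (\<lambda>p. h p i) \<in> forms k e"
  shows "(\<lambda>p. F (h p)) \<in> forms k (d * e)"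
proof -
  obtain c where F: "F = (\<lambda>x. \<Sum>\<alpha>\<in>exponents n d. c \<alpha> * (\<Prod>i\<le>n. x i ^ \<alpha> i))"
    using assms unfolding forms_def by blast
  have "(\<lambda>p. \<Prod>i\<le>n. h p i ^ \<alpha> i) \<in> forms k (d * e)" if "\<alpha> \<in> exponents n d" for \<alpha>
  proof -
    have "(\<lambda>p. \<Prod>i\<le>n. h p i ^ \<alpha> i) \<in> forms k (\<Sum>i\<le>n. \<alpha> i * e)"
      using assms by (intro forms_prod forms_power) auto
    then show ?thesis
      using that by (simp add: exponents_def flip: sum_distrib_right)
  qed
  then show ?thesis
    unfolding F by (intro forms_sum forms_cmult)
qed

lemma forms_homogeneous:
  assumes "F \<in> forms n d"
  shows "F (\<lambda>i. c * x i) = c ^ d * F x"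
proof -
  obtain c' where F: "F = (\<lambda>x. \<Sum>\<alpha>\<in>exponents n d. c' \<alpha> * (\<Prod>i\<le>n. x i ^ \<alpha> i))"
    using assms unfolding forms_def by blast
  have "(\<Prod>i\<le>n. (c * x i) ^ \<alpha> i) = c ^ d * (\<Prod>i\<le>n. x i ^ \<alpha> i)" if "\<alpha> \<in> exponents n d" for \<alpha>
    using that by (simp add: exponents_def power_mult_distrib prod.distrib flip: power_sum)
  then show ?thesis
    unfolding F sum_distrib_left by (intro sum.cong) auto
qed

section \<open>Binary forms\<close>

text \<open>An exponent vector of degree \<open>d\<close> in two variables is determined by the
  exponent of one of them. The parameter \<open>i\<close> names the variable that will be set to 1
  and \<open>1 - i\<close> the other one, so later arguments treat both charts of the line at
  once.\<close>

lemma binary_form_iff: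
  assumes "i \<le> 1"
  shows "F \<in> forms 1 d \<longleftrightarrow> (\<exists>c. F = (\<lambda>x. \<Sum>k\<le>d. c k * (x i ^ (d - k) * x (1 - i) ^ k)))"
proof
  assume "F \<in> forms 1 d"
  then obtain c where F: "F = (\<lambda>x. \<Sum>\<alpha>\<in>exponents 1 d. c \<alpha> * (\<Prod>i\<le>1. x i ^ \<alpha> i))"
    unfolding forms_def by blast
  define e where "e k = (\<lambda>l::nat. if l = i then d - k else if l = 1 - i then k else 0)" for k
  have i: "i = 0 \<or> i = 1"
    using assms by linarith
  have e: "e (\<alpha> (1 - i)) = \<alpha>" "\<alpha> (1 - i) \<le> d" if "\<alpha> \<in> exponents 1 d" for \<alpha>
    using i that by (auto simp: e_def exponents_def fun_eq_iff)
  have e': "e k \<in> exponents 1 d" "e k (1 - i) = k" if "k \<le> d" for k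
    using i that by (auto simp: e_def exponents_def)
  have e'': "(\<Prod>l\<le>1. x l ^ \<alpha> l) = x i ^ (d - \<alpha> (1 - i)) * x (1 - i) ^ \<alpha> (1 - i)"
    if "\<alpha> \<in> exponents 1 d" for \<alpha> and x :: "'a pt"
    using i that by (auto simp: exponents_def mult_ac)
  have "F x = (\<Sum>k\<le>d. c (e k) * (x i ^ (d - k) * x (1 - i) ^ k))" for x
    unfolding F
    by (rule sum.reindex_bij_witness[of _ e "\<lambda>\<alpha>. \<alpha> (1 - i)"]) (simp_all only: e e' e'' atMost_iff)
  then show "\<exists>c. F = (\<lambda>x. \<Sum>k\<le>d. c k * (x i ^ (d - k) * x (1 - i) ^ k))"
    by (intro exI[of _ "\<lambda>k. c (e k)"]) (rule ext)
next
  assume "\<exists>c. F = (\<lambda>x. \<Sum>k\<le>d. c k * (x i ^ (d - k) * x (1 - i) ^ k))"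
  moreover have "(\<lambda>x. x i ^ (d - k) * x (1 - i) ^ k) \<in> forms 1 d" if "k \<le> d" for k
    using forms_mult[OF forms_var_power[of i 1 "d - k"] forms_var_power[of "1 - i" 1 k]] that assms
    by simp
  ultimately show "F \<in> forms 1 d"
    by (auto intro!: forms_sum forms_cmult)
qed

lemma binary_formI: "(\<lambda>x. \<Sum>k\<le>d. c k * (x 0 ^ (d - k) * x 1 ^ k)) \<in> forms 1 d"
  unfolding binary_form_iff[OF le0] diff_zero by (rule exI[of _ c]) (rule refl)

text \<open>Parametrizes the standard chart number \<open>i\<close> of the line; evaluating a binary
  form along it is dehomogenization.\<close>

definition affine_pt :: "nat \<Rightarrow> 'k::field \<Rightarrow> 'k pt" where
  "affine_pt i y = (\<lambda>k. if k = i then 1 else if k = 1 - i then y else 0)"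

lemma affine_pt_proj: "i \<le> 1 \<Longrightarrow> affine_pt i y \<in> proj 1"
  by (cases i) (auto simp: affine_pt_def proj_def vecs_def fun_eq_iff)

lemma affine_pt_simps: "i \<le> 1 \<Longrightarrow> affine_pt i y i = 1" "i \<le> 1 \<Longrightarrow> affine_pt i y (1 - i) = y"
  by (cases i; simp add: affine_pt_def)+

lemma poly_sum_monom: "poly (\<Sum>k\<le>d. monom (c k) k) y = (\<Sum>k\<le>d. c k * y ^ k)"
  for y :: "'a::comm_semiring_1"
  by (simp add: poly_sum poly_monom)

lemma coeff_sum_monom: "coeff (\<Sum>k\<le>d. monom (c k) k) l = (if l \<le> d then c l else 0)"
  for c :: "nat \<Rightarrow> 'a::comm_monoid_add"
  by (simp add: coeff_sum)

text \<open>Characteristic 0 makes the field infinite, so a polynomial function determines its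
  coefficients. All comparisons of binary forms, which are functions here, reduce to this.\<close>

lemma power_sum_eqD:
  fixes c c' :: "nat \<Rightarrow> 'a::field_char_0"
  assumes "\<And>y. (\<Sum>k\<le>d. c k * y ^ k) = (\<Sum>k\<le>d. c' k * y ^ k)" "k \<le> d"
  shows "c k = c' k"
proof -
  have "(\<Sum>k\<le>d. monom (c k) k) = (\<Sum>k\<le>d. monom (c' k) k)"
    using assms(1) by (simp add: poly_eq_poly_eq_iff[symmetric] poly_sum_monom fun_eq_iff)
  from this[THEN poly_eq_iff[THEN iffD1], THEN spec, of k] show ?thesis
    using assms(2) by (simp add: coeff_sum_monom)
qed

section \<open>Zariski open sets and sections of line bundles\<close>

definition basic_open :: "nat \<Rightarrow> 'k::field fn \<Rightarrow> 'k pt set" where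
  "basic_open n F = {x \<in> proj n. F x \<noteq> 0}"

lemma zopen_basic_open: "F \<in> forms n d \<Longrightarrow> zopen n (basic_open n F)"
  unfolding zopen_def basic_open_def by (intro exI[of _ "{F}"] conjI) blast+

lemma zopen_basicE:
  assumes "zopen n U" "p \<in> U"
  obtains d G where "G \<in> forms n d" "p \<in> basic_open n G" "basic_open n G \<subseteq> U"
proof -
  obtain T where T: "T \<subseteq> (\<Union>d. forms n d)" "U = {x \<in> proj n. \<exists>F\<in>T. F x \<noteq> 0}"
    using assms(1) unfolding zopen_def by (elim exE conjE)
  then obtain G where G: "G \<in> T" "G p \<noteq> 0" "p \<in> proj n"
    using assms(2) by auto
  then obtain d where "G \<in> forms n d"
    using T(1) by blast
  moreover have "p \<in> basic_open n G" "basic_open n G \<subseteq> U"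
    using G T(2) by (auto simp: basic_open_def)
  ultimately show thesis
    by (rule that)
qed

lemma zopen_Int:
  assumes "zopen n U" "zopen n V"
  shows "zopen n (U \<inter> V)"
proof -
  obtain S T where *: "S \<subseteq> (\<Union>d. forms n d)" "U = {x \<in> proj n. \<exists>F\<in>S. F x \<noteq> 0}"
    "T \<subseteq> (\<Union>d. forms n d)" "V = {x \<in> proj n. \<exists>F\<in>T. F x \<noteq> 0}"
    using assms unfolding zopen_def by (elim exE conjE)
  define R where "R = {\<lambda>x. F x * G x |F G. F \<in> S \<and> G \<in> T}"
  have "R \<subseteq> (\<Union>d. forms n d)"
  proof
    fix H assume "H \<in> R"
    then obtain F G where "H = (\<lambda>x. F x * G x)" "F \<in> S" "G \<in> T"
      unfolding R_def by blast
    moreover from this obtain d e where "F \<in> forms n d" "G \<in> forms n e"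
      using *(1,3) by (meson UN_E subsetD)
    ultimately show "H \<in> (\<Union>d. forms n d)"
      using forms_mult[of F n d G e] by (intro UN_I[of "d + e"]) simp_all
  qed
  moreover have "(\<exists>H\<in>R. H x \<noteq> 0) \<longleftrightarrow> (\<exists>F\<in>S. F x \<noteq> 0) \<and> (\<exists>G\<in>T. G x \<noteq> 0)" for x
    unfolding R_def by fastforce
  then have "U \<inter> V = {x \<in> proj n. \<exists>F\<in>R. F x \<noteq> 0}"
    using *(2,4) by blast
  ultimately show ?thesis
    unfolding zopen_def by (intro exI[of _ R] conjI)
qed

lemma cut_apply [simp]: "x \<in> U \<Longrightarrow> cut U f x = f x" "x \<notin> U \<Longrightarrow> cut U f x = 0"
  by (simp_all add: cut_def)

lemma line_bundle_simps [simp]: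
  "scal (line_bundle n m) = (*)" "restr (line_bundle n m) = cut"
  by (simp_all add: line_bundle_def)

lemma line_bundle_vanish: "f \<in> sections (line_bundle n m) U \<Longrightarrow> x \<notin> U \<Longrightarrow> f x = 0"
  by (simp add: line_bundle_def)

text \<open>Packs the local condition from \<open>line_bundle\<close>, with the two degrees hidden,
  so that a local fraction can be passed around as one fact.\<close>

definition quotient_on :: "nat \<Rightarrow> int \<Rightarrow> 'k::field pt set \<Rightarrow> 'k fn \<Rightarrow> 'k fn \<Rightarrow> 'k fn \<Rightarrow> bool" where
  "quotient_on n m V P Q f \<longleftrightarrow> (\<exists>d e. P \<in> forms n d \<and> Q \<in> forms n e \<and> int d - int e = m) \<and>
     (\<forall>x\<in>V. Q x \<noteq> 0 \<and> f x = P x / Q x)"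

lemma line_bundle_section_iff:
  "f \<in> sections (line_bundle n m) U \<longleftrightarrow> (\<forall>x. x \<notin> U \<longrightarrow> f x = 0) \<and>
     (\<forall>p\<in>U. \<exists>V P Q. zopen n V \<and> p \<in> V \<and> V \<subseteq> U \<and> quotient_on n m V P Q f)"
proof -
  have "(\<exists>V d e. \<exists>P\<in>A d. \<exists>Q\<in>A e. a V \<and> b V \<and> c V \<and> D d e \<and> R V P Q) \<longleftrightarrow>
      (\<exists>V P Q. a V \<and> b V \<and> c V \<and> (\<exists>d e. P \<in> A d \<and> Q \<in> A e \<and> D d e) \<and> R V P Q)"
    for A :: "nat \<Rightarrow> 'a fn set" and a b c :: "'a pt set \<Rightarrow> bool" and D R
    by blast
  then have "(\<exists>V d e. \<exists>P\<in>forms n d. \<exists>Q\<in>forms n e. zopen n V \<and> p \<in> V \<and> V \<subseteq> U \<and>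
        int d - int e = m \<and> (\<forall>x\<in>V. Q x \<noteq> 0 \<and> f x = P x / Q x)) \<longleftrightarrow>
      (\<exists>V P Q. zopen n V \<and> p \<in> V \<and> V \<subseteq> U \<and> quotient_on n m V P Q f)" for p
    unfolding quotient_on_def .
  then show ?thesis
    by (simp only: line_bundle_def sheaf.select_convs mem_Collect_eq)
qed

lemma line_bundle_localE:
  assumes "f \<in> sections (line_bundle n m) U" "p \<in> U"
  obtains V P Q where "zopen n V" "p \<in> V" "V \<subseteq> U" "quotient_on n m V P Q f"
proof -
  have "\<exists>V P Q. zopen n V \<and> p \<in> V \<and> V \<subseteq> U \<and> quotient_on n m V P Q f"
    using assms unfolding line_bundle_section_iff by simp
  then show thesis
    by (elim exE conjE) (rule that)
qed

lemma line_bundle_sectionI: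
  assumes "\<And>x. x \<notin> U \<Longrightarrow> f x = 0"
    and "\<And>p. p \<in> U \<Longrightarrow> \<exists>V P Q. zopen n V \<and> p \<in> V \<and> V \<subseteq> U \<and> quotient_on n m V P Q f"
  shows "f \<in> sections (line_bundle n m) U"
  using assms unfolding line_bundle_section_iff by simp

lemma line_bundle_quotient:
  assumes "P \<in> forms n d" "Q \<in> forms n e" "int d - int e = m" "zopen n U"
    "\<And>x. x \<in> U \<Longrightarrow> Q x \<noteq> 0"
  shows "cut U (\<lambda>x. P x / Q x) \<in> sections (line_bundle n m) U"
proof (rule line_bundle_sectionI)
  have "quotient_on n m U P Q (cut U (\<lambda>x. P x / Q x))"
    unfolding quotient_on_def using assms by (intro conjI exI[of _ d] exI[of _ e]) auto
  then show "\<exists>V P' Q'. zopen n V \<and> p \<in> V \<and> V \<subseteq> U \<and> quotient_on n m V P' Q' (cut U (\<lambda>x. P x / Q x))"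
    if "p \<in> U" for p
    using that assms(4) by blast
qed simp

lemma quotient_on_cong:
  "quotient_on n m V P Q f \<Longrightarrow> W \<subseteq> V \<Longrightarrow> (\<And>x. x \<in> W \<Longrightarrow> g x = f x) \<Longrightarrow> quotient_on n m W P Q g"
  unfolding quotient_on_def by auto

text \<open>Sections are functions, so agreement on overlaps is automatic and only the local shape
  has to be checked; the open neighbourhood is supplied by the local fraction of
  \<open>g\<close>.\<close>

lemma line_bundle_glue:
  assumes "\<And>x. x \<notin> U \<Longrightarrow> f x = 0"
    and "\<And>p. p \<in> U \<Longrightarrow> \<exists>V g. p \<in> V \<and> V \<subseteq> U \<and> g \<in> sections (line_bundle n m) V \<and> (\<forall>x\<in>V. f x = g x)"
  shows "f \<in> sections (line_bundle n m) U"
proof (rule line_bundle_sectionI)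
  fix p assume p: "p \<in> U"
  obtain V g where V: "p \<in> V" "V \<subseteq> U" "g \<in> sections (line_bundle n m) V" "\<forall>x\<in>V. f x = g x"
    using assms(2)[OF p] by (elim exE conjE)
  obtain W P Q where W: "zopen n W" "p \<in> W" "W \<subseteq> V" "quotient_on n m W P Q g"
    using V(3,1) by (rule line_bundle_localE)
  then have "quotient_on n m W P Q f"
    using V by (intro quotient_on_cong[OF W(4)]) auto
  with W V show "\<exists>V P Q. zopen n V \<and> p \<in> V \<and> V \<subseteq> U \<and> quotient_on n m V P Q f"
    by (intro exI[of _ W] exI[of _ P] exI[of _ Q]) auto
qed (rule assms(1))

lemma line_bundle_cut:
  assumes "f \<in> sections (line_bundle n m) U" "zopen n V" "V \<subseteq> U"
  shows "cut V f \<in> sections (line_bundle n m) V"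
proof (rule line_bundle_sectionI)
  fix p assume p: "p \<in> V"
  then have "p \<in> U"
    using assms(3) by blast
  with assms(1) obtain W P Q where W: "zopen n W" "p \<in> W" "W \<subseteq> U" "quotient_on n m W P Q f"
    by (rule line_bundle_localE)
  have "quotient_on n m (W \<inter> V) P Q (cut V f)"
    by (intro quotient_on_cong[OF W(4)]) auto
  then show "\<exists>W P Q. zopen n W \<and> p \<in> W \<and> W \<subseteq> V \<and> quotient_on n m W P Q (cut V f)"
    using W p zopen_Int[OF W(1) assms(2)]
    by (intro exI[of _ "W \<inter> V"] exI[of _ P] exI[of _ Q]) auto
qed simp

lemma line_bundle_mult_form:
  assumes "f \<in> sections (line_bundle n m) U" "G \<in> forms n g"
  shows "(\<lambda>x. G x * f x) \<in> sections (line_bundle n (m + int g)) U"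
proof (rule line_bundle_sectionI)
  fix p assume "p \<in> U"
  with assms(1) obtain W P Q where W: "zopen n W" "p \<in> W" "W \<subseteq> U" "quotient_on n m W P Q f"
    by (rule line_bundle_localE)
  then obtain d e where PQ: "P \<in> forms n d" "Q \<in> forms n e" "int d - int e = m"
    unfolding quotient_on_def by blast
  then have "(\<lambda>x. G x * P x) \<in> forms n (g + d)" "int (g + d) - int e = m + int g"
    using forms_mult[OF assms(2)] by auto
  with PQ(2) have "quotient_on n (m + int g) W (\<lambda>x. G x * P x) Q (\<lambda>x. G x * f x)"
    using W(4) unfolding quotient_on_def by (auto simp del: of_nat_add)
  with W show "\<exists>V P Q. zopen n V \<and> p \<in> V \<and> V \<subseteq> U \<and> quotient_on n (m + int g) V P Q (\<lambda>x. G x * f x)"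
    by (intro exI[of _ W] exI[of _ "\<lambda>x. G x * P x"] exI[of _ Q]) auto
qed (simp add: line_bundle_vanish[OF assms(1)])

text \<open>The numeral 1 is both the dimension of the line and a coordinate index; rewriting it to
  \<open>Suc 0\<close> would keep the facts stated with \<open>1\<close> from matching.\<close>

declare One_nat_def [simp del]

section \<open>Graded modules of binary forms without common zeros\<close>

text \<open>
  Dehomogenizing the members of M gives an ideal of the ring of univariate polynomials; a generator of
  positive degree would have a root, which is excluded.  So the ideal contains 1, and the
  homogenizations of 1 are the powers of the variable.
\<close>

lemma graded_module_contains_power:
  fixes M :: "nat \<Rightarrow> 'k::{alg_closed_field, field_char_0} fn set"
  assumes r: "1 \<le> r" and i: "i \<le> 1"
    and sub: "\<And>d. M d \<subseteq> forms 1 d"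
    and add: "\<And>d G H. G \<in> M d \<Longrightarrow> H \<in> M d \<Longrightarrow> (\<lambda>x. G x + H x) \<in> M d"
    and mult: "\<And>d k G A. G \<in> M d \<Longrightarrow> A \<in> forms 1 (r * k) \<Longrightarrow> (\<lambda>x. A x * G x) \<in> M (d + r * k)"
    and cong: "\<And>d e G H. G \<in> M d \<Longrightarrow> H \<in> M e \<Longrightarrow> d \<le> e \<Longrightarrow> r dvd e - d"
    and nz: "\<And>p. p \<in> proj 1 \<Longrightarrow> \<exists>d. \<exists>G\<in>M d. G p \<noteq> 0"
  shows "\<exists>N. (\<lambda>x. x i ^ N) \<in> M N"
proof -
  define J where "J = {u. \<exists>d. \<exists>G\<in>M d. \<forall>y. G (affine_pt i y) = poly u y}"
  have JI: "u \<in> J" if "G \<in> M d" "\<And>y. G (affine_pt i y) = poly u y" for u G d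
    using that unfolding J_def by auto
  have JE: "\<exists>d G. G \<in> M d \<and> (\<forall>y. G (affine_pt i y) = poly u y)" if "u \<in> J" for u
    using that unfolding J_def by auto
  note a = affine_pt_simps[OF i]
  have J_smult: "smult c u \<in> J" if u: "u \<in> J" for c u
  proof -
    obtain d G where G: "G \<in> M d" "\<forall>y. G (affine_pt i y) = poly u y"
      using JE[OF u] by (elim exE conjE)
    show ?thesis
      by (rule JI[OF mult[OF G(1), of "\<lambda>_. c" 0]]) (simp_all add: forms_const G(2))
  qed
  have J_pCons: "pCons 0 u \<in> J" if u: "u \<in> J" for u
  proof -
    obtain d G where G: "G \<in> M d" "\<forall>y. G (affine_pt i y) = poly u y"
      using JE[OF u] by (elim exE conjE)
    \<comment> \<open>Only forms of degree divisible by \<open>r\<close> act on \<open>M\<close>.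
      This one has degree exactly \<open>r\<close> and takes the value \<open>y\<close> at
      \<open>affine_pt i y\<close>, hence realizes multiplication by the affine coordinate.\<close>
    have "(\<lambda>x. x i ^ (r - 1) * x (1 - i)) \<in> forms 1 (r - 1 + 1)"
      using i by (intro forms_mult forms_var_power forms_var) auto
    then have "(\<lambda>x. x i ^ (r - 1) * x (1 - i)) \<in> forms 1 (r * 1)"
      using r by simp
    then show ?thesis
      by (rule JI[OF mult[OF G(1)]]) (simp add: G(2) a)
  qed
  have J_add': "u + v \<in> J" if G: "G \<in> M d" "\<forall>y. G (affine_pt i y) = poly u y"
    and H: "H \<in> M e" "\<forall>y. H (affine_pt i y) = poly v y" and "d \<le> e" for u v G H d e
  proof -
    obtain k where "e - d = r * k"
      using cong[OF G(1) H(1) \<open>d \<le> e\<close>] by (elim dvdE)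
    then have e: "e = d + r * k"
      using \<open>d \<le> e\<close> by simp
    \<comment> \<open>A power of \<open>x i\<close> raises the degree without changing values on the
      chart; its exponent is admissible because the degrees occurring in \<open>M\<close> are
      congruent modulo \<open>r\<close>.\<close>
    have "(\<lambda>x. x i ^ (r * k) * G x) \<in> M e"
      unfolding e by (rule mult[OF G(1)]) (use i in \<open>rule forms_var_power\<close>)
    then show ?thesis
      by (rule JI[OF add[OF _ H(1)]]) (simp add: G(2) H(2) a)
  qed
  have J_add: "u + v \<in> J" if uv: "u \<in> J" "v \<in> J" for u v
  proof -
    obtain d G where G: "G \<in> M d" "\<forall>y. G (affine_pt i y) = poly u y"
      using JE[OF uv(1)] by (elim exE conjE)
    obtain e H where H: "H \<in> M e" "\<forall>y. H (affine_pt i y) = poly v y"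
      using JE[OF uv(2)] by (elim exE conjE)
    show ?thesis
      using J_add'[OF G H] J_add'[OF H G] by (cases "d \<le> e") (auto simp: add.commute)
  qed
  have J_mult: "q * u \<in> J" if "u \<in> J" for q u
  proof (induction q)
    case 0
    then show ?case using J_smult[OF that, of 0] by simp
  next
    case (pCons b q)
    then show ?case
      using J_add[OF J_smult[OF that] J_pCons[OF pCons(2)]] by simp
  qed
  have J_point: "\<exists>u\<in>J. poly u y \<noteq> 0" for y
  proof -
    obtain d G where G: "G \<in> M d" "G (affine_pt i y) \<noteq> 0"
      using nz[OF affine_pt_proj[OF i, of y]] by auto
    then obtain c where c: "G = (\<lambda>x. \<Sum>k\<le>d. c k * (x i ^ (d - k) * x (1 - i) ^ k))"
      using sub[of d] binary_form_iff[OF i, of G d] by auto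
    have p: "G (affine_pt i y) = poly (\<Sum>k\<le>d. monom (c k) k) y" for y
      unfolding c poly_sum_monom by (simp add: a)
    then have "(\<Sum>k\<le>d. monom (c k) k) \<in> J"
      by (rule JI[OF G(1)])
    then show ?thesis
      using G(2) unfolding p by (rule bexI[rotated])
  qed
  obtain u0 where "u0 \<in> J" "poly u0 0 \<noteq> 0"
    using J_point[of 0] by auto
  then have "u0 \<in> J \<and> u0 \<noteq> 0"
    by auto
  then obtain u where u: "u \<in> J" "u \<noteq> 0" and least: "\<And>v. v \<in> J \<Longrightarrow> v \<noteq> 0 \<Longrightarrow> degree u \<le> degree v"
    using ex_has_least_nat[of "\<lambda>u. u \<in> J \<and> u \<noteq> 0" u0 degree] by auto
  have "degree u = 0"
  proof (rule ccontr)
    assume "degree u \<noteq> 0"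
    then obtain z where z: "poly u z = 0"
      using alg_closed_imp_poly_has_root[of u] by auto
    obtain v where v: "v \<in> J" "poly v z \<noteq> 0"
      using J_point by auto
    have "v mod u = v + (- (v div u)) * u"
      by (simp add: minus_div_mult_eq_mod[symmetric])
    then have "v mod u \<in> J"
      using J_add[OF v(1) J_mult[OF u(1)]] by metis
    then have "v mod u = 0"
      using least[of "v mod u"] degree_mod_less[OF u(2), of v] by linarith
    then have "poly v z = poly (v div u) z * poly u z"
      by (metis add.right_neutral div_mult_mod_eq poly_mult)
    with z v(2) show False by simp
  qed
  then obtain c where "u = [:c:]"
    by (rule degree_eq_zeroE)
  with u(2) have "smult (inverse c) u = 1"
    by (auto simp: one_pCons)
  with J_smult[OF u(1)] have "1 \<in> J" by metis
  then obtain d G where G: "G \<in> M d" "\<forall>y. G (affine_pt i y) = poly 1 y"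
    using JE by blast
  then obtain c where c: "G = (\<lambda>x. \<Sum>k\<le>d. c k * (x i ^ (d - k) * x (1 - i) ^ k))"
    using sub[of d] binary_form_iff[OF i, of G d] by auto
  have "(\<Sum>k\<le>d. c k * y ^ k) = (\<Sum>k\<le>d. (if k = 0 then 1 else 0) * y ^ k)" for y
    using G(2)[rule_format, of y] unfolding c by (simp add: a if_distrib[of "\<lambda>z. z * _"] cong: if_cong)
  then have ck: "c k = (if k = 0 then 1 else 0)" if "k \<le> d" for k
    by (rule power_sum_eqD) (rule that)
  have "G = (\<lambda>x. x i ^ d)"
  proof
    fix x
    have "G x = (\<Sum>k\<le>d. (if k = 0 then 1 else 0) * (x i ^ (d - k) * x (1 - i) ^ k))"
      unfolding c using ck by (intro sum.cong) auto
    then show "G x = x i ^ d"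
      by (simp add: if_distrib[of "\<lambda>z. z * _"] cong: if_cong)
  qed
  with G(1) show ?thesis by (intro exI[of _ d]) simp
qed

lemma proj1_cases:
  assumes "p \<in> proj 1"
  obtains i where "i \<le> 1" "p i \<noteq> 0"
proof -
  obtain i where "p i \<noteq> 0"
    using assms by (auto simp: proj_def fun_eq_iff)
  then show thesis
    using assms by (intro that[of i]) (auto simp: proj_def vecs_def not_less[symmetric])
qed

section \<open>Global sections of line bundles on the projective line\<close>

text \<open>Together with \<open>sum_extend_coeffs\<close> this brings a binary form multiplied by a
  power of either variable to a common range of summation, ready for
  \<open>power_sum_eqD\<close>.\<close>

lemma sum_shift_coeffs:
  fixes c :: "nat \<Rightarrow> 'k::comm_semiring_0"
  shows "(\<Sum>k\<le>d. c k * f (k + m)) = (\<Sum>k\<le>d + m. (if m \<le> k then c (k - m) else 0) * f k)"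
proof -
  have "(\<Sum>k\<le>d + m. (if m \<le> k then c (k - m) else 0) * f k) = (\<Sum>k\<in>{m..d + m}. c (k - m) * f k)"
    by (rule sum.mono_neutral_cong_right) auto
  also have "\<dots> = (\<Sum>k\<le>d. c k * f (k + m))"
    by (rule sum.reindex_bij_witness[of _ "\<lambda>k. k + m" "\<lambda>k. k - m"]) auto
  finally show ?thesis ..
qed

lemma sum_extend_coeffs:
  fixes c :: "nat \<Rightarrow> 'k::comm_semiring_0"
  shows "(\<Sum>k\<le>d. c k * f k) = (\<Sum>k\<le>d + m. (if k \<le> d then c k else 0) * f k)"
  by (rule sum.mono_neutral_cong_left) auto

text \<open>Since \<open>f\<close> is locally a fraction, its denominators have no common zero and
  contain a power of each variable. Thus \<open>x 0 ^ N * f\<close> and \<open>x 1 ^ N' * f\<close>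
  are forms, and comparing their coefficients shows that the powers cancel.\<close>

lemma line_bundle_global_section:
  fixes f :: "'k::{alg_closed_field, field_char_0} fn"
  assumes f: "f \<in> sections (line_bundle 1 (int d)) (proj 1)"
  obtains F where "F \<in> forms 1 d" "f = cut (proj 1) F"
proof -
  text \<open>The graded ideal of denominators of f.\<close>
  define M where "M e = {Q \<in> forms 1 e. \<exists>P\<in>forms 1 (d + e). \<forall>x\<in>proj 1. Q x * f x = P x}" for e
  have power: "\<exists>N P. P \<in> forms 1 (d + N) \<and> (\<forall>x\<in>proj 1. x i ^ N * f x = P x)" if "i \<le> 1" for i
  proof -
    have "\<exists>N. (\<lambda>x. x i ^ N) \<in> M N"
    proof (rule graded_module_contains_power[of 1 i M])
      show "(1::nat) \<le> 1" "i \<le> 1" "\<And>d e :: nat. 1 dvd e - d"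
        using that by auto
      show "M e \<subseteq> forms 1 e" for e
        by (auto simp: M_def)
      show "(\<lambda>x. G x + H x) \<in> M e" if GH: "G \<in> M e" "H \<in> M e" for e G H
      proof -
        obtain P P' where "P \<in> forms 1 (d + e)" "P' \<in> forms 1 (d + e)"
          "\<forall>x\<in>proj 1. G x * f x = P x" "\<forall>x\<in>proj 1. H x * f x = P' x"
          using GH by (auto simp: M_def)
        then show ?thesis
          using GH unfolding M_def
          by (auto intro!: forms_add bexI[of _ "\<lambda>x. P x + P' x"] simp: algebra_simps)
      qed
      show "(\<lambda>x. A x * G x) \<in> M (e + 1 * k)" if GA: "G \<in> M e" "A \<in> forms 1 (1 * k)" for e G A k
      proof -
        obtain P where P: "P \<in> forms 1 (d + e)" "\<forall>x\<in>proj 1. G x * f x = P x"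
          using GA by (auto simp: M_def)
        have "(\<lambda>x. A x * P x) \<in> forms 1 (k + (d + e))" "(\<lambda>x. A x * G x) \<in> forms 1 (k + e)"
          using GA P by (auto intro!: forms_mult simp: M_def)
        then show ?thesis
          using P unfolding M_def
          by (auto intro!: bexI[of _ "\<lambda>x. A x * P x"] simp: algebra_simps)
      qed
      show "\<exists>e. \<exists>Q\<in>M e. Q p \<noteq> 0" if p: "p \<in> proj 1" for p
      proof -
        obtain V P Q where V: "zopen 1 V" "p \<in> V" "V \<subseteq> proj 1" "quotient_on 1 (int d) V P Q f"
          using f p by (rule line_bundle_localE)
        then obtain d' e where PQ: "P \<in> forms 1 d'" "Q \<in> forms 1 e" "int d' - int e = int d"
          and q: "\<forall>x\<in>V. Q x \<noteq> 0 \<and> f x = P x / Q x"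
          unfolding quotient_on_def by (elim exE conjE)
        have d': "d' = d + e"
          using PQ(3) by linarith
        obtain g G where G: "G \<in> forms 1 g" "p \<in> basic_open 1 G" "basic_open 1 G \<subseteq> V"
          using V(1,2) by (rule zopen_basicE)
        \<comment> \<open>The fraction \<open>P / Q\<close> represents \<open>f\<close> on
          \<open>V\<close> only. Multiplying by \<open>G\<close>, which vanishes on the rest of the
          line, makes the relation between numerator and denominator hold everywhere.\<close>
        have "(\<lambda>x. P x * G x) \<in> forms 1 (d + (e + g))" "(\<lambda>x. Q x * G x) \<in> forms 1 (e + g)"
          using forms_mult[OF PQ(1) G(1)] forms_mult[OF PQ(2) G(1)] d' by (simp_all add: add.assoc)
        moreover have "Q x * G x * f x = P x * G x" if "x \<in> proj 1" for x
          using that q G(3) by (cases "G x = 0") (auto simp: basic_open_def)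
        ultimately have "(\<lambda>x. Q x * G x) \<in> M (e + g)"
          unfolding M_def by (auto intro!: bexI[of _ "\<lambda>x. P x * G x"])
        moreover have "Q p * G p \<noteq> 0"
          using q V(2) G(2) by (auto simp: basic_open_def)
        ultimately show ?thesis
          by (intro exI[of _ "e + g"] bexI[of _ "\<lambda>x. Q x * G x"])
      qed
    qed
    then show ?thesis
      unfolding M_def by auto
  qed
  obtain N P where P: "P \<in> forms 1 (d + N)" "\<forall>x\<in>proj 1. x 0 ^ N * f x = P x"
    using power[of 0] by auto
  obtain N' P' where P': "P' \<in> forms 1 (d + N')" "\<forall>x\<in>proj 1. x 1 ^ N' * f x = P' x"
    using power[of 1] by auto
  obtain c where c: "P = (\<lambda>x. \<Sum>k\<le>d + N. c k * (x 0 ^ (d + N - k) * x 1 ^ k))"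
    using P(1) binary_form_iff[of 0 P] by auto
  obtain c' where c': "P' = (\<lambda>x. \<Sum>k\<le>d + N'. c' k * (x 0 ^ (d + N' - k) * x 1 ^ k))"
    using P'(1) binary_form_iff[of 0 P'] by auto
  \<comment> \<open>Both sides are \<open>x 0 ^ N * x 1 ^ N' * f\<close>, computed from
    \<open>P\<close> and from \<open>P'\<close> and evaluated at the point (1, y).\<close>
  have "(\<Sum>k\<le>d + N + N'. (if N' \<le> k then c (k - N') else 0) * y ^ k) =
      (\<Sum>k\<le>d + N + N'. (if k \<le> d + N' then c' k else 0) * y ^ k)" for y
  proof -
    have "y ^ N' * P (affine_pt 0 y) = P' (affine_pt 0 y)"
      using P(2)[rule_format, of "affine_pt 0 y"] P'(2)[rule_format, of "affine_pt 0 y"]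
      by (simp add: affine_pt_proj[of 0 y] affine_pt_simps[of 0 y, simplified])
    then have "(\<Sum>k\<le>d + N. c k * y ^ (k + N')) = (\<Sum>k\<le>d + N'. c' k * y ^ k)"
      unfolding c c' by (simp add: affine_pt_def sum_distrib_left power_add mult_ac)
    then show ?thesis
      unfolding sum_shift_coeffs[of c] sum_extend_coeffs[of c' _ "d + N'" N] by (simp add: add_ac)
  qed
  then have coeffs: "(if N' \<le> k then c (k - N') else 0) = (if k \<le> d + N' then c' k else 0)"
    if "k \<le> d + N + N'" for k
    by (rule power_sum_eqD) (rule that)
  \<comment> \<open>The side coming from \<open>P'\<close> has no terms beyond \<open>d + N'\<close>
    in the second variable, so the coefficients of \<open>P\<close> beyond \<open>d\<close> vanish,
    that is, \<open>x 0 ^ N\<close> divides \<open>P\<close>.\<close>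
  have c0: "c k = 0" if "d < k" "k \<le> d + N" for k
    using coeffs[of "k + N'"] that by auto
  have c'_eq: "c' k = (if N' \<le> k then c (k - N') else 0)" if "k \<le> d + N'" for k
    using coeffs[of k] that by auto
  define F where "F = (\<lambda>x :: 'k pt. \<Sum>k\<le>d. c k * (x 0 ^ (d - k) * x 1 ^ k))"
  have P_eq: "P x = x 0 ^ N * F x" for x
  proof -
    have "P x = (\<Sum>k\<le>d. c k * (x 0 ^ (d + N - k) * x 1 ^ k))"
      unfolding c using c0 by (intro sum.mono_neutral_right) auto
    also have "\<dots> = x 0 ^ N * F x"
      unfolding F_def sum_distrib_left
      by (intro sum.cong) (auto simp: mult_ac add.commute[of d N] simp flip: power_add)
    finally show ?thesis .
  qed
  have P'_eq: "P' x = x 1 ^ N' * F x" for x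
  proof -
    have "P' x = (\<Sum>k\<le>d + N'. (if N' \<le> k then c (k - N') else 0) * (x 0 ^ (d + N' - k) * x 1 ^ k))"
      unfolding c' using c'_eq by (intro sum.cong) auto
    also have "\<dots> = x 1 ^ N' * F x"
      unfolding F_def sum_distrib_left
      by (subst sum_shift_coeffs[symmetric]) (auto simp: mult_ac power_add intro!: sum.cong)
    finally show ?thesis .
  qed
  have "f x = F x" if x: "x \<in> proj 1" for x
  proof -
    obtain i where "i \<le> 1" "x i \<noteq> 0"
      using x by (rule proj1_cases)
    then have "x 0 \<noteq> 0 \<or> x 1 \<noteq> 0"
      by (cases "i = 0") (auto simp: le_less)
    then show ?thesis
      using P(2) P'(2) x by (auto simp: P_eq P'_eq)
  qed
  then have "f = cut (proj 1) F"
    using line_bundle_vanish[OF f] by (auto simp: cut_def fun_eq_iff)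
  moreover have "F \<in> forms 1 d"
    unfolding F_def using binary_form_iff[of 0 _ d] by auto
  ultimately show thesis
    using that by blast
qed

section \<open>Dimension count\<close>

text \<open>Rank-nullity for a map that is linear only on \<open>V\<close>: a basis of the kernel
  together with lifts of the \<open>g k\<close> is a basis of \<open>V\<close>. Independence of the
  \<open>g k\<close> is stated through coefficients because they form an indexed family; this also
  forces them to be distinct.\<close>

lemma (in vector_space) dim_kernel:
  fixes f :: "'b \<Rightarrow> 'c::ab_group_add" and s :: "'a \<Rightarrow> 'c \<Rightarrow> 'c"
  assumes s: "vector_space s"
    and V: "subspace V" "V \<subseteq> span T" "finite T"
    and add: "\<And>v w. v \<in> V \<Longrightarrow> w \<in> V \<Longrightarrow> f (v + w) = f v + f w"
    and scale: "\<And>c v. v \<in> V \<Longrightarrow> f (scale c v) = s c (f v)"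
    and range: "\<And>v. v \<in> V \<Longrightarrow> \<exists>c. f v = (\<Sum>k\<le>d. s (c k) (g k))"
    and onto: "\<And>k. k \<le> d \<Longrightarrow> \<exists>v\<in>V. f v = g k"
    and indep: "\<And>c k. (\<Sum>k\<le>d. s (c k) (g k)) = 0 \<Longrightarrow> k \<le> d \<Longrightarrow> c k = 0"
  shows "dim V = dim {v \<in> V. f v = 0} + (d + 1)"
proof -
  interpret S: vector_space s by (rule s)
  define W where "W = {v \<in> V. f v = 0}"
  note VS = subspace_0[OF V(1)] subspace_add[OF V(1)] subspace_scale[OF V(1)] subspace_sum[OF V(1)]
  have f0: "f 0 = 0"
    using scale[OF VS(1), of 0] by simp
  have f_sum: "f (\<Sum>i\<in>I. scale (c i) (h i)) = (\<Sum>i\<in>I. s (c i) (f (h i)))"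
    if "\<And>i. i \<in> I \<Longrightarrow> h i \<in> V" for c :: "'i \<Rightarrow> 'a" and h I
    using that
  proof (induction I rule: infinite_finite_induct)
    case (insert i I)
    then show ?case by (simp add: add scale VS)
  qed (simp_all add: f0)
  obtain v where v: "\<And>k. k \<le> d \<Longrightarrow> v k \<in> V \<and> f (v k) = g k"
    using onto by metis
  obtain B where B: "B \<subseteq> W" "independent B" "W \<subseteq> span B" "card B = dim W"
    by (rule basis_exists)
  have "B \<subseteq> span T"
    using B(1) V(2) by (auto simp: W_def)
  then have finB: "finite B"
    using independent_span_bound[OF V(3) B(2)] by simp
  have BV: "b \<in> V" "f b = 0" if "b \<in> B" for b
    using that B(1) by (auto simp: W_def)
  \<comment> \<open>For the cardinality count the lifts must avoid \<open>B\<close> and differ from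
    each other. Otherwise some \<open>g k\<close> is zero or two of them agree, which contradicts
    \<open>indep\<close> for the coefficients 1, respectively 1 and -1.\<close>
  have vB: "v k \<notin> B" if "k \<le> d" for k
  proof
    assume "v k \<in> B"
    then have "g k = 0"
      using BV v[OF that] by auto
    then have "(\<Sum>i\<le>d. s ((if i = k then 1 else 0)) (g i)) = 0"
      by (intro sum.neutral) auto
    from indep[OF this that] show False by simp
  qed
  have inj: "inj_on v {..d}"
  proof (rule inj_onI, rule ccontr)
    fix k l assume kl: "k \<in> {..d}" "l \<in> {..d}" "v k = v l" "k \<noteq> l"
    then have "g k = g l"
      using v by (metis atMost_iff)
    have "(\<Sum>i\<le>d. s (if i = k then 1 else if i = l then - 1 else 0) (g i)) =
        (\<Sum>i\<in>{k, l}. s (if i = k then 1 else if i = l then - 1 else 0) (g i))"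
      by (rule sum.mono_neutral_right) (use kl in auto)
    also have "\<dots> = 0"
      using kl(4) \<open>g k = g l\<close> by simp
    finally show False
      using indep[of "\<lambda>i. if i = k then 1 else if i = l then - 1 else 0" k] kl(1) by simp
  qed
  have "dim V = card (B \<union> v ` {..d})"
  proof (rule dim_unique)
    show "B \<union> v ` {..d} \<subseteq> V"
      using BV v by auto
    show "V \<subseteq> span (B \<union> v ` {..d})"
    proof
      fix x assume x: "x \<in> V"
      then obtain c where c: "f x = (\<Sum>k\<le>d. s (c k) (g k))"
        using range by blast
      define y where "y = (\<Sum>k\<le>d. scale (c k) (v k))"
      have "f y = f x"
        unfolding y_def c using v by (subst f_sum) auto
      moreover have y: "y \<in> V"
        unfolding y_def using v by (intro VS(4,3)) auto
      ultimately have "f (x - y) = 0"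
        using add[OF x VS(3)[OF y, of "- 1"]] scale[OF y, of "- 1"] by simp
      moreover have "x - y \<in> V"
        using x y V(1) by (rule subspace_diff[rotated])
      ultimately have "x - y \<in> span B"
        using B(3) by (auto simp: W_def)
      then have "x - y \<in> span (B \<union> v ` {..d})"
        by (rule subsetD[OF span_mono, rotated]) simp
      moreover have "y \<in> span (B \<union> v ` {..d})"
        unfolding y_def by (intro span_sum span_scale span_base) auto
      ultimately have "(x - y) + y \<in> span (B \<union> v ` {..d})"
        by (rule span_add)
      then show "x \<in> span (B \<union> v ` {..d})" by simp
    qed
    show "independent (B \<union> v ` {..d})"
    proof (rule independent_if_scalars_zero)
      show "finite (B \<union> v ` {..d})"
        using finB by simp
      fix u x assume 0: "(\<Sum>x\<in>B \<union> v ` {..d}. scale (u x) x) = 0" and x: "x \<in> B \<union> v ` {..d}"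
      have split: "(\<Sum>x\<in>B \<union> v ` {..d}. scale (u x) x) =
          (\<Sum>x\<in>B. scale (u x) x) + (\<Sum>k\<le>d. scale (u (v k)) (v k))"
        using finB vB inj by (subst sum.union_disjoint) (auto simp: sum.reindex)
      have "f (\<Sum>x\<in>B \<union> v ` {..d}. scale (u x) x) =
          (\<Sum>x\<in>B. s (u x) (f x)) + (\<Sum>k\<le>d. s (u (v k)) (f (v k)))"
        unfolding split using BV v f_sum[of B "\<lambda>x. x" u] f_sum[of "{..d}" v "\<lambda>k. u (v k)"]
        by (subst add) (auto intro!: VS(4,3))
      also have "\<dots> = (\<Sum>k\<le>d. s (u (v k)) (g k))"
        using BV v by (simp add: sum.neutral)
      finally have "(\<Sum>k\<le>d. s (u (v k)) (g k)) = 0"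
        unfolding 0 f0 by simp
      then have uv: "u (v k) = 0" if "k \<le> d" for k
        using indep[of "\<lambda>k. u (v k)"] that by simp
      then have "(\<Sum>x\<in>B. scale (u x) x) = 0"
        using 0 unfolding split by simp
      then have "u x = 0" if "x \<in> B" for x
        using independentD[OF B(2) finB subset_refl] that by blast
      with uv x show "u x = 0" by auto
    qed
  qed simp
  also have "\<dots> = card B + card (v ` {..d})"
    using finB vB by (intro card_Un_disjoint) auto
  finally show ?thesis
    using inj by (simp add: card_image B(4) W_def)
qed

global_interpretation fn: vector_space "\<lambda>c (f :: 'a \<Rightarrow> 'k::field) x. c * f x"
  by unfold_locales (auto simp: algebra_simps fun_eq_iff)

lemma fn_subspaceI:
  assumes "(\<lambda>x. 0) \<in> S" "\<And>F G. F \<in> S \<Longrightarrow> G \<in> S \<Longrightarrow> (\<lambda>x. F x + G x) \<in> S"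
    "\<And>c F. F \<in> S \<Longrightarrow> (\<lambda>x. c * F x) \<in> S"
  shows "fn.subspace S"
  using assms unfolding fn.subspace_def by (simp add: zero_fun_def plus_fun_def)

lemma forms_finite_span: "\<exists>T. finite T \<and> forms n d \<subseteq> fn.span T"
proof (intro exI conjI subsetI)
  let ?T = "(\<lambda>\<alpha> x. \<Prod>i\<le>n. x i ^ \<alpha> i :: 'a) ` exponents n d"
  show "finite ?T"
    by (intro finite_imageI finite_exponents)
  fix F :: "'a fn" assume "F \<in> forms n d"
  then obtain c where c: "F = (\<lambda>x. \<Sum>\<alpha>\<in>exponents n d. c \<alpha> * (\<Prod>i\<le>n. x i ^ \<alpha> i))"
    unfolding forms_def by blast
  have "(\<Sum>\<alpha>\<in>exponents n d. (\<lambda>x. c \<alpha> * (\<Prod>i\<le>n. x i ^ \<alpha> i))) \<in> fn.span ?T"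
    by (intro fn.span_sum fn.span_scale fn.span_base imageI)
  moreover have "F = (\<Sum>\<alpha>\<in>exponents n d. (\<lambda>x. c \<alpha> * (\<Prod>i\<le>n. x i ^ \<alpha> i)))"
    by (simp add: c sum_fun_apply fun_eq_iff)
  ultimately show "F \<in> fn.span ?T"
    by simp
qed

text \<open>Cut off like the sections of line bundles, so that these monomials are a basis of the
  global sections of O(d) as functions.\<close>

definition binary_monomial :: "nat \<Rightarrow> nat \<Rightarrow> 'k::field fn" where
  "binary_monomial d k = cut (proj 1) (\<lambda>x. x 0 ^ (d - k) * x 1 ^ k)"

text \<open>Instance of rank-nullity for a map onto the global sections of O(d), which have the
  \<open>d + 1\<close> monomials as a basis. It is applied to restriction to the curve and to
  \<open>form_map\<close>.\<close>

lemma fn_dim_kernel: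
  fixes \<Phi> :: "'k::field_char_0 fn \<Rightarrow> 'k fn"
  assumes V: "V \<subseteq> forms n t" "(\<lambda>x. 0) \<in> V" "\<And>F G. F \<in> V \<Longrightarrow> G \<in> V \<Longrightarrow> (\<lambda>x. F x + G x) \<in> V"
    "\<And>c F. F \<in> V \<Longrightarrow> (\<lambda>x. c * F x) \<in> V"
    and add: "\<And>F G. F \<in> V \<Longrightarrow> G \<in> V \<Longrightarrow> \<Phi> (\<lambda>x. F x + G x) = (\<lambda>p. \<Phi> F p + \<Phi> G p)"
    and scale: "\<And>c F. F \<in> V \<Longrightarrow> \<Phi> (\<lambda>x. c * F x) = (\<lambda>p. c * \<Phi> F p)"
    and range: "\<Phi> ` V = cut (proj 1) ` forms 1 d"
  shows "fn_dim V = fn_dim {F \<in> V. \<Phi> F = (\<lambda>p. 0)} + (d + 1)"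
proof -
  obtain T where T: "finite T" "(forms n t :: 'k fn set) \<subseteq> fn.span T"
    using forms_finite_span by blast
  have cut_sum: "cut (proj 1) (\<lambda>x. \<Sum>k\<le>d. c k * (x 0 ^ (d - k) * x 1 ^ k)) =
      (\<Sum>k\<le>d. (\<lambda>x. c k * binary_monomial d k x))" for c :: "nat \<Rightarrow> 'k"
    by (auto simp: cut_def binary_monomial_def sum_fun_apply fun_eq_iff)
  have "fn_dim V = fn_dim {F \<in> V. \<Phi> F = 0} + (d + 1)"
  proof (rule fn.dim_kernel[where T = T and g = "binary_monomial d"])
    show "fn.subspace V"
      using V(2-4) by (rule fn_subspaceI)
    show "V \<subseteq> fn.span T" "finite T"
      using V(1) T by auto
    show "\<Phi> (F + G) = \<Phi> F + \<Phi> G" if "F \<in> V" "G \<in> V" for F G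
      using add[OF that] by (simp add: plus_fun_def)
    show "\<exists>c. \<Phi> F = (\<Sum>k\<le>d. (\<lambda>x. c k * binary_monomial d k x))" if F: "F \<in> V" for F
    proof -
      obtain H where "H \<in> forms 1 d" "\<Phi> F = cut (proj 1) H"
        using range F by (metis imageE imageI)
      then obtain c where "\<Phi> F = cut (proj 1) (\<lambda>x. \<Sum>k\<le>d. c k * (x 0 ^ (d - k) * x 1 ^ k))"
        using binary_form_iff[of 0 H] by auto
      then show ?thesis
        unfolding cut_sum by blast
    qed
    show "\<exists>F\<in>V. \<Phi> F = binary_monomial d k" if "k \<le> d" for k
    proof -
      have "(\<lambda>x. x 0 ^ (d - k) * x 1 ^ k) \<in> forms 1 (d - k + k)"
        by (intro forms_mult forms_var_power) auto
      then have "binary_monomial d k \<in> \<Phi> ` V"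
        unfolding range binary_monomial_def using that by (intro imageI) simp
      then show ?thesis by auto
    qed
    show "c k = 0" if 0: "(\<Sum>k\<le>d. (\<lambda>x. c k * binary_monomial d k x)) = 0" and k: "k \<le> d" for c :: "nat \<Rightarrow> 'k" and k
    proof -
      have "(\<Sum>k\<le>d. c k * y ^ k) = (\<Sum>k\<le>d. 0 * y ^ k)" for y
        using fun_cong[OF 0, of "affine_pt 0 y"] affine_pt_proj[of 0 y] affine_pt_simps[of 0 y]
        by (simp add: sum_fun_apply binary_monomial_def)
      from power_sum_eqD[OF this k] show ?thesis .
    qed
  qed (use scale in \<open>auto intro: fn.vector_space_axioms\<close>)
  then show ?thesis
    by (simp add: zero_fun_def)
qed

section \<open>Rational normal curves\<close>

definition unit_vec :: "nat \<Rightarrow> 'k::field pt" where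
  "unit_vec k = (\<lambda>i. if i = k then 1 else 0)"

lemma linear_on_vecs_expand:
  fixes L :: "'k::field pt \<Rightarrow> 'k pt"
  assumes add: "\<And>x y. x \<in> vecs r \<Longrightarrow> y \<in> vecs r \<Longrightarrow> L (x + y) = L x + L y"
    and scale: "\<And>c x. x \<in> vecs r \<Longrightarrow> L (\<lambda>i. c * x i) = (\<lambda>i. c * L x i)"
    and x: "x \<in> vecs r"
  shows "L x i = (\<Sum>k\<le>r. x k * L (unit_vec k) i)"
proof -
  have vecs: "(\<lambda>i. c * unit_vec k i) \<in> vecs r" "unit_vec k \<in> vecs r" "0 \<in> vecs r"
    if "k \<le> r" for k and c :: 'k
    using that by (auto simp: vecs_def unit_vec_def)
  have vecs_sum: "(\<Sum>k\<in>K. (\<lambda>i. x k * unit_vec k i)) \<in> vecs r" if "K \<subseteq> {..r}" for K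
    using that vecs by (auto simp: vecs_def sum_fun_apply intro!: sum.neutral)
  have L0: "L 0 = 0"
    using scale[OF vecs(3)[of r], of 0] by (simp add: fun_eq_iff zero_fun_def)
  have L_sum: "L (\<Sum>k\<in>K. (\<lambda>i. x k * unit_vec k i)) = (\<Sum>k\<in>K. (\<lambda>i. x k * L (unit_vec k) i))"
    if "finite K" "K \<subseteq> {..r}" for K
    using that
  proof induction
    case (insert k K)
    then show ?case
      using add[of "\<lambda>i. x k * unit_vec k i", OF vecs(1) vecs_sum[of K]] scale[OF vecs(2)[of k]]
      by (simp add: plus_fun_def)
  qed (simp add: L0)
  have "x i = (\<Sum>k\<le>r. (\<lambda>i. x k * unit_vec k i)) i" for i
  proof -
    have "(\<Sum>k\<le>r. x k * unit_vec k i) = (\<Sum>k\<le>r. if k = i then x k else 0)"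
      by (rule sum.cong) (auto simp: unit_vec_def)
    then show ?thesis
      using x by (simp add: sum_fun_apply vecs_def)
  qed
  then have "x = (\<Sum>k\<le>r. (\<lambda>i. x k * unit_vec k i))"
    by (rule ext)
  then have "L x = L (\<Sum>k\<le>r. (\<lambda>i. x k * unit_vec k i))"
    by (rule arg_cong)
  also have "\<dots> = (\<Sum>k\<le>r. (\<lambda>i. x k * L (unit_vec k) i))"
    by (rule L_sum) simp_all
  finally have "L x i = (\<Sum>k\<le>r. (\<lambda>i. x k * L (unit_vec k) i)) i"
    by (rule fun_cong)
  then show ?thesis
    by (simp only: sum_fun_apply)
qed

lemma linear_embedding_left_inverse:
  fixes L :: "'k::field pt \<Rightarrow> 'k pt"
  assumes L: "linear_embedding r n L"
  obtains l where "\<forall>k. l k \<in> forms n 1" "\<forall>k. \<forall>x\<in>vecs r. l k (L x) = x k"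
proof -
  let ?s = "\<lambda>c (x :: 'k pt) i. c * x i"
  interpret vector_space_pair ?s ?s by unfold_locales
  \<comment> \<open>\<open>L\<close> is linear on \<open>vecs r\<close> only. Truncating first gives
    a map linear on all functions, to which the existence of a linear left inverse on a subspace
    applies.\<close>
  define t where "t x = (\<lambda>i. if i \<le> r then x i else 0)" for x :: "'k pt"
  have t: "t x \<in> vecs r" "x \<in> vecs r \<Longrightarrow> t x = x" for x
    by (auto simp: t_def vecs_def fun_eq_iff)
  have "Vector_Spaces.linear ?s ?s (L \<circ> t)"
  proof (unfold_locales, goal_cases)
    case (1 x y)
    have "t (x + y) = t x + t y"
      by (auto simp: t_def)
    then show ?case
      using L t by (simp add: linear_embedding_def)
  next
    case (2 c x)
    have "t (?s c x) = ?s c (t x)"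
      by (auto simp: t_def)
    then show ?case
      using L t by (simp add: linear_embedding_def)
  qed
  moreover have "fn.subspace (vecs r :: 'k pt set)"
    by (rule fn_subspaceI) (auto simp: vecs_def)
  moreover have "inj_on (L \<circ> t) (vecs r)"
    using L t by (auto simp: linear_embedding_def inj_on_def)
  ultimately obtain g where g: "Vector_Spaces.linear ?s ?s g" "\<forall>x\<in>vecs r. g ((L \<circ> t) x) = x"
    using linear_exists_left_inverse_on by blast
  interpret g: Vector_Spaces.linear ?s ?s g by (rule g(1))
  have expand: "g x k = (\<Sum>i\<le>n. x i * g (unit_vec i) k)" if "x \<in> vecs n" for x k
    by (rule linear_on_vecs_expand[OF g.add g.scale that])
  show thesis
  proof
    show "\<forall>k. (\<lambda>x. \<Sum>i\<le>n. g (unit_vec i) k * x i) \<in> forms n 1"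
      by (intro allI forms_sum forms_cmult forms_var) auto
    show "\<forall>k. \<forall>x\<in>vecs r. (\<Sum>i\<le>n. g (unit_vec i) k * L x i) = x k"
    proof (intro allI ballI)
      fix k x assume that: "(x :: 'k pt) \<in> vecs r"
      have "g (L x) = x" "L x \<in> vecs n"
        using g(2) t that L by (auto simp: linear_embedding_def)
      then show "(\<Sum>i\<le>n. g (unit_vec i) k * L x i) = x k"
        using expand[of "L x" k] by (simp add: mult.commute)
    qed
  qed
qed

locale rational_normal =
  fixes n r :: nat and j :: "'k::{alg_closed_field, field_char_0} pt \<Rightarrow> 'k pt" and C :: "'k pt set"
  assumes degree_pos: "1 \<le> r" and curve: "rational_normal_curve n r j C"
begin

lemma veronese_vecs: "veronese r p \<in> vecs r"
  by (simp add: veronese_def vecs_def)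

lemma embeddingE:
  obtains L where "linear_embedding r n L" "\<forall>p. j p = L (veronese r p)"
  using curve unfolding rational_normal_curve_def by auto

lemma param_coordinate: "(\<lambda>p. j p i) \<in> forms 1 r"
proof -
  obtain L where L: "linear_embedding r n L" "\<forall>p. j p = L (veronese r p)"
    by (rule embeddingE)
  note lin = L(1)[unfolded linear_embedding_def]
  have "j p i = (\<Sum>k\<le>r. veronese r p k * L (unit_vec k) i)" for p
    unfolding L(2)[rule_format]
  proof (rule linear_on_vecs_expand)
    show "L (x + y) = L x + L y" if "x \<in> vecs r" "y \<in> vecs r" for x y
      using lin[THEN conjunct2, THEN conjunct1, rule_format, OF that] .
    show "L (\<lambda>i. c * x i) = (\<lambda>i. c * L x i)" if "x \<in> vecs r" for c x
      using lin[THEN conjunct2, THEN conjunct2, THEN conjunct1, rule_format, OF that] .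
  qed (rule veronese_vecs)
  moreover have "(\<Sum>k\<le>r. veronese r p k * L (unit_vec k) i) =
      (\<Sum>k\<le>r. L (unit_vec k) i * (p 0 ^ (r - k) * p 1 ^ k))" for p
    by (rule sum.cong) (simp_all add: veronese_def mult.commute)
  ultimately have "(\<lambda>p. j p i) = (\<lambda>p. \<Sum>k\<le>r. L (unit_vec k) i * (p 0 ^ (r - k) * p 1 ^ k))"
    by presburger
  also have "\<dots> \<in> forms 1 r"
    by (rule binary_formI)
  finally show ?thesis .
qed

text \<open>The coordinates of a left inverse of the embedding are linear forms on the ambient
  space; along the curve they recover the monomials of the Veronese map.\<close>

lemma coordinate_lift:
  obtains l where "\<forall>k. l k \<in> forms n 1" "\<forall>k\<le>r. \<forall>p. l k (j p) = p 0 ^ (r - k) * p 1 ^ k"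
proof -
  obtain L where L: "linear_embedding r n L" "\<forall>p. j p = L (veronese r p)"
    by (rule embeddingE)
  obtain l where l: "\<forall>k. l k \<in> forms n 1" "\<forall>k. \<forall>x\<in>vecs r. l k (L x) = x k"
    using L(1) by (rule linear_embedding_left_inverse)
  show thesis
    by (rule that[OF l(1)]) (simp add: L(2) l(2) veronese_vecs, simp add: veronese_def)
qed

text \<open>Linear forms recover \<open>p 0 ^ r\<close> and \<open>p 1 ^ r\<close> from
  \<open>j p\<close>, so \<open>j p = 0\<close> would force both coordinates of \<open>p\<close> to
  vanish.\<close>

lemma param_proj:
  assumes "p \<in> proj 1"
  shows "j p \<in> proj n"
proof -
  obtain L where L: "linear_embedding r n L" "\<forall>p. j p = L (veronese r p)"
    by (rule embeddingE)
  obtain l where l: "\<forall>k. l k \<in> forms n 1" "\<forall>k\<le>r. \<forall>p. l k (j p) = p 0 ^ (r - k) * p 1 ^ k"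
    by (rule coordinate_lift)
  obtain i where i: "i \<le> 1" "p i \<noteq> 0"
    using assms by (rule proj1_cases)
  have "j p \<noteq> 0"
  proof
    assume 0: "j p = 0"
    have "l k (j p) = 0" for k
      unfolding 0 using forms_homogeneous[OF l(1)[rule_format, of k], of 0 0] by (simp add: zero_fun_def)
    then have "p 0 ^ r = 0" "p 1 ^ r = 0"
      using l(2)[rule_format, of 0 p] l(2)[rule_format, of r p] by simp_all
    with i show False
      by (cases "i = 0") (auto simp: le_less)
  qed
  then show ?thesis
    using L veronese_vecs by (auto simp: proj_def linear_embedding_def)
qed

lemma param_coordinate_nonzero:
  assumes "p \<in> proj 1"
  obtains i where "i \<le> n" "j p i \<noteq> 0"
proof -
  obtain i where "j p i \<noteq> 0"
    using param_proj[OF assms] by (auto simp: proj_def fun_eq_iff)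
  then show thesis
    using param_proj[OF assms] by (intro that[of i]) (auto simp: proj_def vecs_def not_less[symmetric])
qed

text \<open>Projective normality of the rational normal curve: every binary monomial of degree
  \<open>r * t\<close> is a product of \<open>t\<close> monomials of degree \<open>r\<close>, and
  each of those lifts to a linear form.\<close>

lemma forms_lift:
  assumes "G \<in> forms 1 (r * t)"
  obtains F where "F \<in> forms n t" "\<forall>p. F (j p) = G p"
proof -
  obtain l where l: "\<forall>k. l k \<in> forms n 1" "\<forall>k\<le>r. \<forall>p. l k (j p) = p 0 ^ (r - k) * p 1 ^ k"
    by (rule coordinate_lift)
  have mono: "\<exists>F\<in>forms n t. \<forall>p. F (j p) = p 0 ^ (r * t - b) * p 1 ^ b" if "b \<le> r * t" for b t
    using that
  proof (induction t arbitrary: b)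
    case 0
    then show ?case
      by (intro bexI[OF _ forms_const[of 1]]) simp
  next
    case (Suc t)
    \<comment> \<open>Greedy choice of the factor to split off: it takes as much of the second
      variable as a monomial of degree \<open>r\<close> can hold, which leaves an exponent of at
      most \<open>r * t\<close>.\<close>
    define k where "k = min b r"
    have k: "k \<le> r" "b - k \<le> r * t"
      using Suc.prems unfolding k_def mult_Suc_right by linarith+
    obtain F where F: "F \<in> forms n t" "\<forall>p. F (j p) = p 0 ^ (r * t - (b - k)) * p 1 ^ (b - k)"
      by (rule bexE[OF Suc.IH[OF k(2)]]) (rule that)
    have "(\<lambda>x. F x * l k x) \<in> forms n (Suc t)"
      using forms_mult[OF F(1) l(1)[rule_format, of k]] by (simp only: Suc_eq_plus1)
    moreover have "F (j p) * l k (j p) = p 0 ^ (r * Suc t - b) * p 1 ^ b" for p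
    proof -
      have "r * Suc t - b = r * t - (b - k) + (r - k)"
        using Suc.prems unfolding k_def mult_Suc_right by linarith
      then have "p 0 ^ (r * Suc t - b) = p 0 ^ (r * t - (b - k)) * p 0 ^ (r - k)"
        by (simp only: power_add)
      moreover have "p 1 ^ b = p 1 ^ (b - k) * p 1 ^ k"
        by (simp add: k_def flip: power_add)
      ultimately show ?thesis
        using F(2) l(2) k(1) by (simp only: mult_ac)
    qed
    ultimately show ?case
      by (intro bexI[of _ "\<lambda>x. F x * l k x"]) auto
  qed
  obtain c where c: "G = (\<lambda>x. \<Sum>k\<le>r * t. c k * (x 0 ^ (r * t - k) * x 1 ^ k))"
    using assms binary_form_iff[of 0 G] by auto
  have "\<forall>b\<in>{..r * t}. \<exists>F. F \<in> forms n t \<and> (\<forall>p. F (j p) = p 0 ^ (r * t - b) * p 1 ^ b)"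
  proof
    fix b assume "b \<in> {..r * t}"
    then show "\<exists>F. F \<in> forms n t \<and> (\<forall>p. F (j p) = p 0 ^ (r * t - b) * p 1 ^ b)"
      using mono[of b t] by (simp only: Bex_def atMost_iff)
  qed
  from bchoice[OF this] obtain H
    where H: "\<forall>b\<in>{..r * t}. H b \<in> forms n t \<and> (\<forall>p. H b (j p) = p 0 ^ (r * t - b) * p 1 ^ b)"
    by (elim exE)
  show thesis
  proof
    show "(\<lambda>x. \<Sum>k\<le>r * t. c k * H k x) \<in> forms n t"
      using H by (intro forms_sum forms_cmult) auto
    show "\<forall>p. (\<Sum>k\<le>r * t. c k * H k (j p)) = G p"
      unfolding c using H by (intro allI sum.cong) auto
  qed
qed

lemma forms_param: "F \<in> forms n t \<Longrightarrow> (\<lambda>p. F (j p)) \<in> forms 1 (r * t)"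
  using forms_compose[of F n t j, OF _ param_coordinate] by (simp only: mult.commute)

lemma curve_eq: "C = {x. \<exists>p\<in>proj 1. \<exists>c. c \<noteq> 0 \<and> x = (\<lambda>i. c * j p i)}"
  using curve unfolding rational_normal_curve_def by (rule conjunct2)

lemma param_in_curve: "p \<in> proj 1 \<Longrightarrow> j p \<in> C"
  unfolding curve_eq mem_Collect_eq by (intro bexI exI[of _ 1] conjI) simp_all

lemma curveE:
  assumes "x \<in> C"
  obtains p c where "p \<in> proj 1" "c \<noteq> 0" "x = (\<lambda>i. c * j p i)"
  using assms unfolding curve_eq mem_Collect_eq by (elim bexE exE conjE)

lemma curve_subset: "C \<subseteq> proj n"
proof
  fix x assume "x \<in> C"
  then obtain p c where p: "p \<in> proj 1" "c \<noteq> 0" "x = (\<lambda>i. c * j p i)"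
    by (rule curveE)
  then show "x \<in> proj n"
    using param_proj[OF p(1)] by (auto simp: proj_def vecs_def fun_eq_iff)
qed

lemma form_vanishes_on_curve_iff:
  assumes "F \<in> forms n t"
  shows "(\<forall>x\<in>C. F x = 0) \<longleftrightarrow> (\<forall>p\<in>proj 1. F (j p) = 0)"
proof
  assume *: "\<forall>p\<in>proj 1. F (j p) = 0"
  show "\<forall>x\<in>C. F x = 0"
  proof
    fix x assume "x \<in> C"
    then obtain p c where "p \<in> proj 1" "c \<noteq> 0" "x = (\<lambda>i. c * j p i)"
      by (rule curveE)
    then show "F x = 0"
      using * forms_homogeneous[OF assms, of c "j p"] by simp
  qed
qed (simp add: param_in_curve)

lemma preim_subset: "U \<subseteq> V \<Longrightarrow> preim j U \<subseteq> preim j V"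
  by (auto simp: preim_def)

lemma preim_basic_open: "preim j (basic_open n F) = basic_open 1 (\<lambda>p. F (j p))"
  using param_proj by (auto simp: preim_def basic_open_def)

lemma zopen_preim:
  assumes "zopen n U"
  shows "zopen 1 (preim j U)"
proof -
  obtain T where T: "T \<subseteq> (\<Union>d. forms n d)" "U = {x \<in> proj n. \<exists>F\<in>T. F x \<noteq> 0}"
    using assms unfolding zopen_def by (elim exE conjE)
  have "(\<lambda>F p. F (j p)) ` T \<subseteq> (\<Union>d. forms 1 d)"
  proof (rule image_subsetI)
    fix F assume "F \<in> T"
    then obtain d where "F \<in> forms n d"
      using T(1) by (meson UN_E subsetD)
    then show "(\<lambda>p. F (j p)) \<in> (\<Union>d. forms 1 d)"
      using forms_param[of F d] by (intro UN_I[of "r * d"]) simp_all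
  qed
  moreover have "preim j U = {x \<in> proj 1. \<exists>F\<in>(\<lambda>F p. F (j p)) ` T. F x \<noteq> 0}"
    using param_proj by (auto simp: preim_def T(2))
  ultimately show ?thesis
    unfolding zopen_def by (intro exI conjI)
qed

text \<open>The degree of \<open>Q\<close> need not be divisible by \<open>r\<close>, but
  \<open>Q ^ r\<close> has the same zeros and degree \<open>r * e\<close>, so it lifts. Hence the
  topology of the line is induced from the ambient space.\<close>

lemma basic_open_lift:
  assumes "Q \<in> forms 1 e"
  obtains G where "G \<in> forms n e" "preim j (basic_open n G) = basic_open 1 Q"
proof -
  obtain G where G: "G \<in> forms n e" "\<forall>p. G (j p) = Q p ^ r"
    using forms_power[OF assms, of r] by (rule forms_lift)
  have "preim j (basic_open n G) = basic_open 1 Q"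
    unfolding preim_basic_open G(2)[rule_format] using degree_pos by (auto simp: basic_open_def)
  with G(1) show thesis by (rule that)
qed

text \<open>The direct image multiplies by the uncut \<open>a \<circ> j\<close>; cutting it off
  yields an actual regular function, to which linearity of a sheaf map on the line applies.\<close>

lemma pullback_section:
  assumes "a \<in> sections (line_bundle n 0) U"
  shows "cut (preim j U) (a \<circ> j) \<in> sections (line_bundle 1 0) (preim j U)"
proof (rule line_bundle_sectionI)
  fix p assume p: "p \<in> preim j U"
  then have "j p \<in> U"
    by (simp add: preim_def)
  with assms obtain W P Q where W: "zopen n W" "j p \<in> W" "W \<subseteq> U" "quotient_on n 0 W P Q a"
    by (rule line_bundle_localE)
  then obtain d where PQ: "P \<in> forms n d" "Q \<in> forms n d" "\<forall>x\<in>W. Q x \<noteq> 0 \<and> a x = P x / Q x"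
    unfolding quotient_on_def by auto
  have "quotient_on 1 0 (preim j W) (\<lambda>p. P (j p)) (\<lambda>p. Q (j p)) (cut (preim j U) (a \<circ> j))"
    unfolding quotient_on_def
    using PQ(3) W(3) forms_param[OF PQ(1)] forms_param[OF PQ(2)]
    by (intro conjI exI[of _ "r * d"]) (auto simp: preim_def cut_def)
  then show "\<exists>V P Q. zopen 1 V \<and> p \<in> V \<and> V \<subseteq> preim j U \<and> quotient_on 1 0 V P Q (cut (preim j U) (a \<circ> j))"
    using zopen_preim[OF W(1)] preim_subset[OF W(3)] p W(2)
    by (intro exI[of _ "preim j W"] exI[of _ "\<lambda>p. P (j p)"] exI[of _ "\<lambda>p. Q (j p)"])
      (auto simp: preim_def)
qed simp

end

section \<open>Maps from the ideal sheaf of the curve to a line bundle\<close>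

lemma ideal_sheaf_iff:
  "f \<in> sections (ideal_sheaf n C) U \<longleftrightarrow>
     f \<in> sections (line_bundle n 0) U \<and> (\<forall>x \<in> U \<inter> C. f x = 0)"
  by (simp add: ideal_sheaf_def)

definition chart :: "nat \<Rightarrow> nat \<Rightarrow> 'k::field pt set" where
  "chart n i = {x \<in> proj n. x i \<noteq> 0}"

definition dehomog :: "nat \<Rightarrow> nat \<Rightarrow> 'k::field fn \<Rightarrow> nat \<Rightarrow> 'k fn" where
  "dehomog n t F i = cut (chart n i) (\<lambda>x. F x / x i ^ t)"

lemma zopen_chart: "i \<le> n \<Longrightarrow> zopen n (chart n i)"
  using zopen_basic_open[OF forms_var] by (simp add: chart_def basic_open_def)

lemma dehomog_section:
  assumes "F \<in> forms n t" "i \<le> n"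
  shows "dehomog n t F i \<in> sections (line_bundle n 0) (chart n i)"
  unfolding dehomog_def
  by (rule line_bundle_quotient[OF assms(1) forms_var_power[OF assms(2)]])
    (simp_all add: zopen_chart[OF assms(2)], simp add: chart_def)

lemma line_bundle_0_cut_quotient:
  assumes "P \<in> forms n d" "Q \<in> forms n d" "zopen n U" "\<And>x. x \<in> U \<Longrightarrow> Q x \<noteq> 0"
  shows "cut U (\<lambda>x. P x / Q x) \<in> sections (line_bundle n 0) U"
  by (rule line_bundle_quotient[OF assms(1,2) _ assms(3)]) (simp_all add: assms(4))

text \<open>Isolates what the count needs from the composite of the conormal map with \<mu>.
  Multiplicativity is stated at points over \<open>U\<close>, so values of
  \<open>a \<circ> j\<close> elsewhere do not enter. Surjectivity onto a line bundle appears as the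
  existence of local sections whose image is nonzero at a given point.\<close>

locale curve_ideal_map = rational_normal n r j C
  for n r :: nat and j :: "'k::{alg_closed_field, field_char_0} pt \<Rightarrow> 'k pt" and C +
  fixes \<phi> :: "'k pt set \<Rightarrow> 'k fn \<Rightarrow> 'k fn" and m :: int
  assumes map_section: "\<And>U f. zopen n U \<Longrightarrow> f \<in> sections (ideal_sheaf n C) U \<Longrightarrow>
      \<phi> U f \<in> sections (line_bundle 1 m) (preim j U)"
    and map_add: "\<And>U f g. zopen n U \<Longrightarrow> f \<in> sections (ideal_sheaf n C) U \<Longrightarrow>
      g \<in> sections (ideal_sheaf n C) U \<Longrightarrow> \<phi> U (f + g) = \<phi> U f + \<phi> U g"
    and map_mult: "\<And>U a f p. zopen n U \<Longrightarrow> a \<in> sections (line_bundle n 0) U \<Longrightarrow>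
      f \<in> sections (ideal_sheaf n C) U \<Longrightarrow> p \<in> preim j U \<Longrightarrow> \<phi> U (a * f) p = a (j p) * \<phi> U f p"
    and map_cut: "\<And>U V f. zopen n U \<Longrightarrow> zopen n V \<Longrightarrow> V \<subseteq> U \<Longrightarrow>
      f \<in> sections (ideal_sheaf n C) U \<Longrightarrow> \<phi> V (cut V f) = cut (preim j V) (\<phi> U f)"
    and map_surj: "\<And>p. p \<in> proj 1 \<Longrightarrow> \<exists>V f. zopen n V \<and> j p \<in> V \<and>
      f \<in> sections (ideal_sheaf n C) V \<and> \<phi> V f p \<noteq> 0"
begin

definition vanishing_forms :: "nat \<Rightarrow> 'k fn set" where
  "vanishing_forms t = {F \<in> forms n t. \<forall>x\<in>C. F x = 0}"

lemma vanishing_forms_mult: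
  "A \<in> forms n s \<Longrightarrow> F \<in> vanishing_forms t \<Longrightarrow> (\<lambda>x. A x * F x) \<in> vanishing_forms (s + t)"
  by (simp add: vanishing_forms_def forms_mult)

lemma vanishing_forms_add:
  "F \<in> vanishing_forms t \<Longrightarrow> G \<in> vanishing_forms t \<Longrightarrow> (\<lambda>x. F x + G x) \<in> vanishing_forms t"
  by (simp add: vanishing_forms_def forms_add)

lemma dehomog_ideal:
  assumes "F \<in> vanishing_forms t" "i \<le> n"
  shows "dehomog n t F i \<in> sections (ideal_sheaf n C) (chart n i)"
  using assms dehomog_section[of F n t i] unfolding ideal_sheaf_iff
  by (simp add: vanishing_forms_def dehomog_def cut_def)

lemma ideal_cut:
  assumes "f \<in> sections (ideal_sheaf n C) U" "zopen n V" "V \<subseteq> U"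
  shows "cut V f \<in> sections (ideal_sheaf n C) V"
proof -
  have "cut V f x = 0" if "x \<in> V \<inter> C" for x
    using assms(1,3) that unfolding ideal_sheaf_iff by (simp add: subset_iff)
  then show ?thesis
    using assms line_bundle_cut[of f n 0 U V] unfolding ideal_sheaf_iff by simp
qed

definition form_index :: "'k pt \<Rightarrow> nat" where
  "form_index p = (SOME i. i \<le> n \<and> j p i \<noteq> 0)"

text \<open>
  The global section of O(m + r t) obtained by gluing the images of the dehomogenizations of F;
  the index chooses a chart around the point.
\<close>

definition form_map :: "nat \<Rightarrow> 'k fn \<Rightarrow> 'k fn" where
  "form_map t F p = (if p \<in> proj 1 then
     j p (form_index p) ^ t * \<phi> (chart n (form_index p)) (dehomog n t F (form_index p)) p else 0)"

lemma form_index: "p \<in> proj 1 \<Longrightarrow> form_index p \<le> n \<and> j p (form_index p) \<noteq> 0"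
  unfolding form_index_def
  by (rule someI_ex) (elim param_coordinate_nonzero, intro exI conjI)

text \<open>Restriction to \<open>W\<close> followed by multiplicativity. This is the computing rule
  behind the independence of the chart, the multiplicativity of \<open>form_map\<close> and its
  nonvanishing.\<close>

lemma map_dehomog_local:
  assumes F: "F \<in> vanishing_forms t" and i: "i \<le> n" and p: "p \<in> proj 1" "j p \<in> W"
    and W: "zopen n W" "W \<subseteq> chart n i"
    and f: "f \<in> sections (ideal_sheaf n C) W" and a: "a \<in> sections (line_bundle n 0) W"
    and eq: "\<And>x. x \<in> W \<Longrightarrow> F x / x i ^ t = a x * f x"
  shows "\<phi> (chart n i) (dehomog n t F i) p = a (j p) * \<phi> W f p"
proof -
  have pW: "p \<in> preim j W"
    using p by (simp add: preim_def)
  have "cut W (dehomog n t F i) x = (a * f) x" for x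
  proof (cases "x \<in> W")
    case True
    then have "x \<in> chart n i"
      using W(2) by blast
    with True show ?thesis
      by (simp add: dehomog_def eq)
  next
    case False
    then show ?thesis
      using line_bundle_vanish[OF a] by simp
  qed
  then have cut_eq: "cut W (dehomog n t F i) = a * f"
    by (rule ext)
  have "\<phi> (chart n i) (dehomog n t F i) p = cut (preim j W) (\<phi> (chart n i) (dehomog n t F i)) p"
    using pW by simp
  also have "\<dots> = \<phi> W (cut W (dehomog n t F i)) p"
    by (simp only: map_cut[OF zopen_chart[OF i] W dehomog_ideal[OF F i]])
  also have "\<dots> = a (j p) * \<phi> W f p"
    unfolding cut_eq by (rule map_mult[OF W(1) a f pW])
  finally show ?thesis .
qed

text \<open>On the overlap of two charts the dehomogenizations differ by the regular factor
  \<open>x i ^ t / x k ^ t\<close>, which comes out of \<phi> and cancels against the powers of the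
  coordinates of \<open>j p\<close>. So the choice made by \<open>form_index\<close> does not
  matter.\<close>

lemma form_map_chart:
  assumes F: "F \<in> vanishing_forms t" and i: "i \<le> n" and p: "p \<in> proj 1" "j p i \<noteq> 0"
  shows "form_map t F p = j p i ^ t * \<phi> (chart n i) (dehomog n t F i) p"
proof -
  define k where "k = form_index p"
  have k: "k \<le> n" "j p k \<noteq> 0"
    using form_index[OF p(1)] by (simp_all add: k_def)
  define W :: "'k pt set" where "W = chart n i \<inter> chart n k"
  have W: "zopen n W" "W \<subseteq> chart n i" "W \<subseteq> chart n k" "j p \<in> W"
    using zopen_Int[OF zopen_chart[OF i] zopen_chart[OF k(1)]] param_proj[OF p(1)] p(2) k(2)
    by (simp_all add: W_def chart_def)
  have ne: "x i \<noteq> 0" "x k \<noteq> 0" if "x \<in> W" for x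
    using that by (simp_all add: W_def chart_def)
  have f: "cut W (dehomog n t F i) \<in> sections (ideal_sheaf n C) W"
    by (rule ideal_cut[OF dehomog_ideal[OF F i] W(1,2)])
  have a: "cut W (\<lambda>x. x i ^ t / x k ^ t) \<in> sections (line_bundle n 0) W"
    by (rule line_bundle_0_cut_quotient[OF forms_var_power[OF i] forms_var_power[OF k(1)] W(1)])
      (simp add: ne)
  have "\<phi> (chart n k) (dehomog n t F k) p =
      cut W (\<lambda>x. x i ^ t / x k ^ t) (j p) * \<phi> W (cut W (dehomog n t F i)) p"
  proof (rule map_dehomog_local[OF F k(1) p(1) W(4,1,3) f a])
    fix x assume x: "x \<in> W"
    then have "x \<in> chart n i"
      using W(2) by blast
    then show "F x / x k ^ t = cut W (\<lambda>x. x i ^ t / x k ^ t) x * cut W (dehomog n t F i) x"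
      using x ne[OF x] by (simp add: dehomog_def)
  qed
  also have "\<phi> W (cut W (dehomog n t F i)) p = \<phi> (chart n i) (dehomog n t F i) p"
    using map_cut[OF zopen_chart[OF i] W(1,2) dehomog_ideal[OF F i]] p(1) W(4)
    by (simp add: preim_def)
  finally show ?thesis
    using p(1) k(2) W(4) by (simp add: form_map_def flip: k_def)
qed

lemma form_map_outside: "p \<notin> proj 1 \<Longrightarrow> form_map t F p = 0"
  by (simp add: form_map_def)

text \<open>In each chart the factor \<open>j p i ^ t\<close> is a binary form of degree
  \<open>r * t\<close>, which accounts for the twist added to \<open>m\<close>.\<close>

lemma form_map_section:
  assumes F: "F \<in> vanishing_forms t"
  shows "form_map t F \<in> sections (line_bundle 1 (m + int (r * t))) (proj 1)"
proof (rule line_bundle_glue)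
  fix p :: "'k pt" assume p: "p \<in> proj 1"
  then obtain i where i: "i \<le> n" "j p i \<noteq> 0"
    by (rule param_coordinate_nonzero)
  let ?V = "preim j (chart n i)" and ?g = "\<lambda>q. j q i ^ t * \<phi> (chart n i) (dehomog n t F i) q"
  have "?g \<in> sections (line_bundle 1 (m + int (t * r))) ?V"
    by (intro line_bundle_mult_form map_section zopen_chart dehomog_ideal F i(1)
        forms_power param_coordinate)
  moreover have "p \<in> ?V" "?V \<subseteq> proj 1"
    using p i(2) param_proj[OF p] by (auto simp: preim_def chart_def)
  moreover have "\<forall>q\<in>?V. form_map t F q = ?g q"
    using form_map_chart[OF F i(1)] by (simp add: preim_def chart_def)
  ultimately show "\<exists>V g. p \<in> V \<and> V \<subseteq> proj 1 \<and>
      g \<in> sections (line_bundle 1 (m + int (r * t))) V \<and> (\<forall>x\<in>V. form_map t F x = g x)"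
    by (intro exI[of _ ?V] exI[of _ ?g]) (simp add: mult.commute[of r t])
qed (rule form_map_outside)

lemma form_map_mult:
  assumes A: "A \<in> forms n s" and F: "F \<in> vanishing_forms t"
  shows "form_map (s + t) (\<lambda>x. A x * F x) p = A (j p) * form_map t F p"
proof (cases "p \<in> proj 1")
  case p: True
  then obtain i where i: "i \<le> n" "j p i \<noteq> 0"
    by (rule param_coordinate_nonzero)
  have jp: "j p \<in> chart n i"
    using param_proj[OF p] i(2) by (simp add: chart_def)
  have "\<phi> (chart n i) (dehomog n (s + t) (\<lambda>x. A x * F x) i) p =
      dehomog n s A i (j p) * \<phi> (chart n i) (dehomog n t F i) p"
    by (rule map_dehomog_local[OF vanishing_forms_mult[OF A F] i(1) p jp zopen_chart[OF i(1)]
          subset_refl dehomog_ideal[OF F i(1)] dehomog_section[OF A i(1)]])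
      (simp add: dehomog_def power_add)
  then show ?thesis
    unfolding form_map_chart[OF F i(1) p i(2)]
      form_map_chart[OF vanishing_forms_mult[OF A F] i(1) p i(2)]
    using i(2) jp by (simp add: dehomog_def power_add)
qed (simp add: form_map_outside)

lemma form_map_add:
  assumes F: "F \<in> vanishing_forms t" and G: "G \<in> vanishing_forms t"
  shows "form_map t (\<lambda>x. F x + G x) p = form_map t F p + form_map t G p"
proof (cases "p \<in> proj 1")
  case p: True
  then obtain i where i: "i \<le> n" "j p i \<noteq> 0"
    by (rule param_coordinate_nonzero)
  have "dehomog n t (\<lambda>x. F x + G x) i = dehomog n t F i + dehomog n t G i"
    by (rule ext) (simp add: dehomog_def cut_def add_divide_distrib)
  then have "\<phi> (chart n i) (dehomog n t (\<lambda>x. F x + G x) i) =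
      \<phi> (chart n i) (dehomog n t F i) + \<phi> (chart n i) (dehomog n t G i)"
    by (simp only: map_add[OF zopen_chart[OF i(1)] dehomog_ideal[OF F i(1)] dehomog_ideal[OF G i(1)]])
  then show ?thesis
    unfolding form_map_chart[OF F i(1) p i(2)] form_map_chart[OF G i(1) p i(2)]
      form_map_chart[OF vanishing_forms_add[OF F G] i(1) p i(2)]
    by (simp add: distrib_left)
qed (simp add: form_map_outside)

text \<open>\<open>form_map\<close> looks at one chart per point, the homogeneous ideal at all of
  them. They agree because \<open>j p i\<close> is invertible on the chart and the images vanish
  outside its preimage.\<close>

lemma form_map_eq_0_iff:
  assumes F: "F \<in> vanishing_forms t"
  shows "form_map t F = (\<lambda>p. 0) \<longleftrightarrow> (\<forall>i\<le>n. \<phi> (chart n i) (dehomog n t F i) = 0)"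
proof (intro iffI allI impI ext)
  fix i p assume 0: "form_map t F = (\<lambda>p. 0)" and i: "i \<le> n"
  show "\<phi> (chart n i) (dehomog n t F i) p = 0 p"
  proof (cases "p \<in> preim j (chart n i)")
    case True
    then have "p \<in> proj 1" "j p i \<noteq> 0"
      by (simp_all add: preim_def chart_def)
    with form_map_chart[OF F i] 0 show ?thesis
      by simp
  next
    case False
    with line_bundle_vanish[OF map_section[OF zopen_chart[OF i] dehomog_ideal[OF F i]]]
    show ?thesis by simp
  qed
next
  fix p assume 0: "\<forall>i\<le>n. \<phi> (chart n i) (dehomog n t F i) = 0"
  show "form_map t F p = 0"
    using 0 form_index[of p] by (simp add: form_map_def)
qed

text \<open>Near \<open>j p\<close> a local section of the ideal is \<open>P / Q\<close>. With
  \<open>G\<close> vanishing off the open set where this holds, the form \<open>P * G\<close>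
  vanishes on all of \<open>C\<close>, and its dehomogenization is locally \<open>f\<close> times
  \<open>Q * G / x i ^ t\<close>, a factor that is nonzero at \<open>j p\<close>.\<close>

lemma form_map_nonzero:
  assumes p: "p \<in> proj 1"
  obtains t F where "F \<in> vanishing_forms t" "form_map t F p \<noteq> 0"
proof -
  obtain V f where V: "zopen n V" "j p \<in> V" and f: "f \<in> sections (ideal_sheaf n C) V"
    and nz: "\<phi> V f p \<noteq> 0"
    using map_surj[OF p] by (elim exE conjE)
  obtain i where i: "i \<le> n" "j p i \<noteq> 0"
    using p by (rule param_coordinate_nonzero)
  have f': "f \<in> sections (line_bundle n 0) V" "\<forall>x \<in> V \<inter> C. f x = 0"
    using f unfolding ideal_sheaf_iff by simp_all
  obtain V' P Q where V': "zopen n V'" "j p \<in> V'" "V' \<subseteq> V" and q: "quotient_on n 0 V' P Q f"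
    using f'(1) V(2) by (rule line_bundle_localE)
  obtain d where PQ: "P \<in> forms n d" "Q \<in> forms n d"
    and eq: "\<forall>x\<in>V'. Q x \<noteq> 0 \<and> f x = P x / Q x"
    using q unfolding quotient_on_def by auto
  obtain g G where G: "G \<in> forms n g" "j p \<in> basic_open n G" "basic_open n G \<subseteq> V'"
    using V'(1,2) by (rule zopen_basicE)
  define t where "t = d + g"
  define F where "F = (\<lambda>x. P x * G x)"
  define W where "W = basic_open n G \<inter> chart n i"
  have W: "j p \<in> W" "zopen n W" "W \<subseteq> chart n i" "W \<subseteq> V"
    using G(2,3) V'(3) param_proj[OF p] i zopen_Int[OF zopen_basic_open[OF G(1)] zopen_chart[OF i(1)]]
    by (auto simp: W_def chart_def)
  have "F x = 0" if x: "x \<in> C" for x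
  proof (cases "G x = 0")
    case False
    then have "x \<in> V'"
      using G(3) x curve_subset by (auto simp: basic_open_def)
    with eq f'(2) V'(3) x have "Q x \<noteq> 0" "f x = P x / Q x" "f x = 0"
      by blast+
    then have "P x / Q x = 0" "Q x \<noteq> 0"
      by simp_all
    then show ?thesis
      by (simp add: F_def)
  qed (simp add: F_def)
  then have F: "F \<in> vanishing_forms t"
    using forms_mult[OF PQ(1) G(1)] by (simp add: vanishing_forms_def F_def t_def)
  have a: "cut W (\<lambda>x. (Q x * G x) / x i ^ t) \<in> sections (line_bundle n 0) W"
    by (rule line_bundle_0_cut_quotient[OF _ forms_var_power[OF i(1)] W(2)])
      (simp_all add: t_def forms_mult[OF PQ(2) G(1)], simp add: W_def chart_def)
  have "\<phi> (chart n i) (dehomog n t F i) p =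
      cut W (\<lambda>x. (Q x * G x) / x i ^ t) (j p) * \<phi> W (cut W f) p"
  proof (rule map_dehomog_local[OF F i(1) p W(1,2,3) ideal_cut[OF f W(2,4)] a])
    fix x assume x: "x \<in> W"
    then have "x \<in> V'"
      using G(3) by (auto simp: W_def)
    then show "F x / x i ^ t = cut W (\<lambda>x. (Q x * G x) / x i ^ t) x * cut W f x"
      using x eq by (simp add: F_def)
  qed
  moreover have "\<phi> W (cut W f) p = \<phi> V f p"
    using map_cut[OF V(1) W(2,4) f] p W(1) by (simp add: preim_def)
  moreover have "Q (j p) \<noteq> 0" "G (j p) \<noteq> 0"
    using eq V'(2) G(2) by (auto simp: basic_open_def)
  ultimately have "form_map t F p \<noteq> 0"
    using form_map_chart[OF F i(1) p i(2)] nz W(1) i(2) by simp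
  with F show thesis
    by (rule that)
qed

end

section \<open>The graded module of images of forms, and the Hilbert function\<close>

context curve_ideal_map
begin

text \<open>Graded by the degree of the binary form. The equation is over the integers because
  \<open>m\<close> may be negative; in degrees not of the form \<open>m + r t\<close> the set is
  empty, so the occurring degrees are congruent modulo \<open>r\<close>.\<close>

definition image_module :: "nat \<Rightarrow> 'k fn set" where
  "image_module d = {G \<in> forms 1 d. \<exists>t F. F \<in> vanishing_forms t \<and> int d = m + int (r * t) \<and>
     form_map t F = cut (proj 1) G}"

lemma image_moduleE:
  assumes "G \<in> image_module d"
  obtains t F where "F \<in> vanishing_forms t" "int d = m + int (r * t)" "form_map t F = cut (proj 1) G"
  using assms unfolding image_module_def mem_Collect_eq by (elim conjE exE)

lemma image_moduleI:
  "G \<in> forms 1 d \<Longrightarrow> F \<in> vanishing_forms t \<Longrightarrow> int d = m + int (r * t) \<Longrightarrow>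
     form_map t F = cut (proj 1) G \<Longrightarrow> G \<in> image_module d"
  unfolding image_module_def mem_Collect_eq by (intro conjI exI)

lemma image_module_forms: "image_module d \<subseteq> forms 1 d"
  by (auto simp: image_module_def)

lemma image_module_add:
  assumes G: "G \<in> image_module d" and H: "H \<in> image_module d"
  shows "(\<lambda>x. G x + H x) \<in> image_module d"
proof -
  obtain t F where F: "F \<in> vanishing_forms t" "int d = m + int (r * t)" "form_map t F = cut (proj 1) G"
    using G by (rule image_moduleE)
  obtain t' F' where F': "F' \<in> vanishing_forms t'" "int d = m + int (r * t')"
    "form_map t' F' = cut (proj 1) H"
    using H by (rule image_moduleE)
  have "r * t' = r * t"
    using F(2) F'(2) by linarith
  then have t': "t' = t"
    using degree_pos by simp
  note F' = F'[unfolded t']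
  have "(\<lambda>x. G x + H x) \<in> forms 1 d"
    using G H image_module_forms by (intro forms_add) auto
  moreover have "form_map t (\<lambda>x. F x + F' x) = cut (proj 1) (\<lambda>x. G x + H x)"
    by (rule ext) (simp add: form_map_add[OF F(1) F'(1)] F(3) F'(3) cut_def)
  ultimately show ?thesis
    using vanishing_forms_add[OF F(1) F'(1)] F(2) by (intro image_moduleI)
qed

lemma image_module_mult:
  assumes G: "G \<in> image_module d" and A: "A \<in> forms 1 (r * k)"
  shows "(\<lambda>x. A x * G x) \<in> image_module (d + r * k)"
proof -
  obtain t F where F: "F \<in> vanishing_forms t" "int d = m + int (r * t)" "form_map t F = cut (proj 1) G"
    using G by (rule image_moduleE)
  obtain B where B: "B \<in> forms n k" "\<forall>p. B (j p) = A p"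
    using A by (rule forms_lift)
  have "G \<in> forms 1 d"
    using G image_module_forms by blast
  then have "(\<lambda>x. A x * G x) \<in> forms 1 (d + r * k)"
    using forms_mult[OF A] by (simp only: add.commute)
  moreover have "form_map (k + t) (\<lambda>x. B x * F x) = cut (proj 1) (\<lambda>x. A x * G x)"
    by (rule ext) (simp add: form_map_mult[OF B(1) F(1)] F(3) B(2) cut_def)
  moreover have "int (d + r * k) = m + int (r * (k + t))"
    using F(2) by (simp add: distrib_left)
  ultimately show ?thesis
    using vanishing_forms_mult[OF B(1) F(1)] by (intro image_moduleI)
qed

lemma image_module_degrees:
  assumes G: "G \<in> image_module d" and H: "H \<in> image_module e" and "d \<le> e"
  shows "r dvd e - d"
proof -
  obtain t where t: "int d = m + int (r * t)"
    using G by (rule image_moduleE)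
  obtain t' where t': "int e = m + int (r * t')"
    using H by (rule image_moduleE)
  have "e - d = r * t' - r * t"
    using t t' by linarith
  also have "\<dots> = r * (t' - t)"
    by (simp only: diff_mult_distrib2)
  finally show ?thesis by simp
qed

lemma form_map_global_form:
  assumes F: "F \<in> vanishing_forms t" and d: "int d = m + int (r * t)"
  obtains G where "G \<in> forms 1 d" "form_map t F = cut (proj 1) G"
  using form_map_section[OF F, folded d] by (rule line_bundle_global_section)

lemma image_module_nonzero:
  assumes p: "p \<in> proj 1"
  shows "\<exists>d. \<exists>G\<in>image_module d. G p \<noteq> 0"
proof -
  obtain t F where F: "F \<in> vanishing_forms t" "form_map t F p \<noteq> 0"
    using p by (rule form_map_nonzero)
  obtain i where i: "i \<le> n" "j p i \<noteq> 0"
    using p by (rule param_coordinate_nonzero)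
  \<comment> \<open>The twist \<open>m + r t\<close> may be negative. Multiplying by
    \<open>x i ^ s\<close> makes it nonnegative, because \<open>r\<close> is at least 1, and keeps
    the value at \<open>p\<close> nonzero.\<close>
  define s where "s = nat \<bar>m\<bar>"
  have F': "(\<lambda>x. x i ^ s * F x) \<in> vanishing_forms (s + t)"
    by (intro vanishing_forms_mult forms_var_power i(1) F(1))
  have "form_map (s + t) (\<lambda>x. x i ^ s * F x) p \<noteq> 0"
    unfolding form_map_mult[OF forms_var_power[OF i(1)] F(1)] using F(2) i(2) by simp
  moreover have "s + t \<le> r * (s + t)"
    using degree_pos by simp
  then have d: "int (nat (m + int (r * (s + t)))) = m + int (r * (s + t))"
    unfolding s_def by linarith
  obtain G where G: "G \<in> forms 1 (nat (m + int (r * (s + t))))"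
    "form_map (s + t) (\<lambda>x. x i ^ s * F x) = cut (proj 1) G"
    using F' d by (rule form_map_global_form)
  ultimately have "G p \<noteq> 0"
    using p by simp
  moreover have "G \<in> image_module (nat (m + int (r * (s + t))))"
    using G F' d by (intro image_moduleI)
  ultimately show ?thesis
    by (intro exI bexI)
qed

lemma image_module_power: "i \<le> 1 \<Longrightarrow> \<exists>N. (\<lambda>x. x i ^ N) \<in> image_module N"
  using degree_pos image_module_forms image_module_add image_module_mult image_module_degrees
    image_module_nonzero
  by (intro graded_module_contains_power[where r = r])

text \<open>A monomial of degree at least \<open>N + N'\<close> is divisible by
  \<open>x 0 ^ N\<close> or by \<open>x 1 ^ N'\<close>, so \<open>D = N + N'\<close> works.\<close>

lemma image_module_large_degree:
  obtains D where "\<And>d t. int d = m + int (r * t) \<Longrightarrow> D \<le> d \<Longrightarrow> image_module d = forms 1 d"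
proof -
  obtain N where N: "(\<lambda>x. x 0 ^ N) \<in> image_module N"
    using image_module_power[of 0] by auto
  obtain N' where N': "(\<lambda>x. x 1 ^ N') \<in> image_module N'"
    using image_module_power[of 1] by auto
  \<comment> \<open>The cofactor must have degree divisible by \<open>r\<close> in order to act;
    this holds because both \<open>d\<close> and \<open>e\<close> are congruent to \<open>m\<close>
    modulo \<open>r\<close>.\<close>
  have shift: "(\<lambda>x. A x * G x) \<in> image_module d"
    if G: "G \<in> image_module e" and d: "int d = m + int (r * t)" and "e \<le> d" and A: "A \<in> forms 1 (d - e)"
    for G A d e t
  proof -
    obtain s where "int e = m + int (r * s)"
      using G by (rule image_moduleE)
    then have "d - e = r * t - r * s"
      using d by linarith
    then have de: "d - e = r * (t - s)"
      by (simp only: diff_mult_distrib2)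
    then have "d = e + r * (t - s)"
      using \<open>e \<le> d\<close> by linarith
    then show ?thesis
      using image_module_mult[OF G A[unfolded de]] by simp
  qed
  have "image_module d = forms 1 d" if d: "int d = m + int (r * t)" "N + N' \<le> d" for d t
  proof (rule antisym[OF image_module_forms], rule subsetI)
    fix G :: "'k fn" assume "G \<in> forms 1 d"
    then obtain c where c: "G = (\<lambda>x. \<Sum>k\<le>d. c k * (x 0 ^ (d - k) * x 1 ^ k))"
      using binary_form_iff[of 0 G] by auto
    have scale: "(\<lambda>x. b * H x) \<in> image_module d" if "H \<in> image_module d" for b H
      using image_module_mult[OF that, of "\<lambda>_. b" 0] by (simp add: forms_const)
    have mono: "(\<lambda>x. x 0 ^ (d - k) * x 1 ^ k) \<in> image_module d" if k: "k \<le> d" for k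
    proof (cases "N \<le> d - k")
      case True
      have "(\<lambda>x. x 0 ^ (d - k - N) * x 1 ^ k) \<in> forms 1 (d - k - N + k)"
        by (intro forms_mult forms_var_power) simp_all
      moreover have "d - k - N + k = d - N" "N \<le> d"
        using True k by simp_all
      ultimately have "(\<lambda>x. (x 0 ^ (d - k - N) * x 1 ^ k) * x 0 ^ N) \<in> image_module d"
        using shift[OF N d(1)] by simp
      moreover have "(x 0 ^ (d - k - N) * x 1 ^ k) * x 0 ^ N = x 0 ^ (d - k) * x 1 ^ k" for x :: "'k pt"
      proof -
        have "x 0 ^ (d - k) = x 0 ^ (d - k - N) * x 0 ^ N"
          using True by (simp only: power_add[symmetric] le_add_diff_inverse2)
        then show ?thesis
          by (simp only: mult_ac)
      qed
      ultimately show ?thesis by (simp only:)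
    next
      case False
      have "(\<lambda>x. x 0 ^ (d - k) * x 1 ^ (k - N')) \<in> forms 1 (d - k + (k - N'))"
        by (intro forms_mult forms_var_power) simp_all
      moreover have "d - k + (k - N') = d - N'" "N' \<le> d" "N' \<le> k"
        using False k d(2) by simp_all
      ultimately have "(\<lambda>x. (x 0 ^ (d - k) * x 1 ^ (k - N')) * x 1 ^ N') \<in> image_module d"
        using shift[OF N' d(1)] by simp
      moreover have "(x 0 ^ (d - k) * x 1 ^ (k - N')) * x 1 ^ N' = x 0 ^ (d - k) * x 1 ^ k" for x :: "'k pt"
        using \<open>N' \<le> k\<close> by (simp only: mult.assoc power_add[symmetric] le_add_diff_inverse2)
      ultimately show ?thesis by (simp only:)
    qed
    have "(\<lambda>x. \<Sum>k\<in>K. c k * (x 0 ^ (d - k) * x 1 ^ k)) \<in> image_module d"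
      if "finite K" "K \<subseteq> {..d}" for K
      using that
    proof induction
      case empty
      show ?case
        using scale[OF mono[of 0], of 0] by simp
    next
      case (insert k K)
      then show ?case
        using image_module_add[OF scale[OF mono[of k], of "c k"]] by simp
    qed
    from this[of "{..d}"] show "G \<in> image_module d"
      unfolding c by simp
  qed
  then show thesis
    by (rule that)
qed

lemma form_map_range:
  assumes d: "int d = m + int (r * t)" and full: "image_module d = forms 1 d"
  shows "form_map t ` vanishing_forms t = cut (proj 1) ` forms 1 d"
proof (intro antisym image_subsetI)
  fix F assume F: "F \<in> vanishing_forms t"
  obtain G where "G \<in> forms 1 d" "form_map t F = cut (proj 1) G"
    using F d by (rule form_map_global_form)
  then show "form_map t F \<in> cut (proj 1) ` forms 1 d"
    by (simp only: imageI)
next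
  fix G :: "'k fn" assume "G \<in> forms 1 d"
  then have "G \<in> image_module d"
    by (simp only: full)
  then obtain s F where F: "F \<in> vanishing_forms s" "int d = m + int (r * s)"
    "form_map s F = cut (proj 1) G"
    by (rule image_moduleE)
  have "r * s = r * t"
    using d F(2) by linarith
  then have "s = t"
    using degree_pos by simp
  then show "cut (proj 1) G \<in> form_map t ` vanishing_forms t"
    using F by (intro image_eqI[of _ _ F]) simp_all
qed

text \<open>Rank-nullity for restriction along \<open>j\<close>, which is onto the binary forms of
  degree \<open>r * t\<close> by \<open>forms_lift\<close>.\<close>

lemma dim_vanishing_forms:
  "fn_dim (forms n t :: 'k fn set) = fn_dim (vanishing_forms t) + (r * t + 1)"
proof -
  let ?R = "\<lambda>F. cut (proj 1) (\<lambda>p. F (j p)) :: 'k fn"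
  have "fn_dim (forms n t :: 'k fn set) = fn_dim {F \<in> forms n t. ?R F = (\<lambda>p. 0)} + (r * t + 1)"
  proof (rule fn_dim_kernel)
    show "?R ` forms n t = cut (proj 1) ` forms 1 (r * t)"
    proof (intro antisym image_subsetI)
      fix F :: "'k fn" assume "F \<in> forms n t"
      then show "?R F \<in> cut (proj 1) ` forms 1 (r * t)"
        by (intro imageI forms_param)
    next
      fix G :: "'k fn" assume "G \<in> forms 1 (r * t)"
      then obtain F where F: "F \<in> forms n t" "\<forall>p. F (j p) = G p"
        by (rule forms_lift)
      then show "cut (proj 1) G \<in> ?R ` forms n t"
        by (intro image_eqI[of _ _ F]) simp_all
    qed
  qed (auto simp: forms_zero forms_add forms_cmult cut_def)
  moreover have "?R F = (\<lambda>p. 0) \<longleftrightarrow> (\<forall>p\<in>proj 1. F (j p) = 0)" for F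
    by (auto simp: cut_def fun_eq_iff)
  then have "{F \<in> forms n t. ?R F = (\<lambda>p. 0)} = vanishing_forms t"
    unfolding vanishing_forms_def
    by (intro Collect_cong conj_cong refl) (simp only: form_vanishes_on_curve_iff)
  ultimately show ?thesis
    by simp
qed

lemma dim_form_map_kernel:
  assumes "int d = m + int (r * t)" "image_module d = forms 1 d"
  shows "fn_dim (vanishing_forms t) = fn_dim {F \<in> vanishing_forms t. form_map t F = (\<lambda>p. 0)} + (d + 1)"
proof (rule fn_dim_kernel[OF _ _ _ _ _ _ form_map_range[OF assms]])
  show "vanishing_forms t \<subseteq> forms n t"
    by (auto simp: vanishing_forms_def)
  show "(\<lambda>x. 0) \<in> vanishing_forms t"
    by (simp add: vanishing_forms_def forms_zero)
  show scale: "(\<lambda>x. c * F x) \<in> vanishing_forms t" if "F \<in> vanishing_forms t" for c F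
    using vanishing_forms_mult[OF forms_const that, of c] by simp
  show "form_map t (\<lambda>x. c * F x) = (\<lambda>p. c * form_map t F p)" if "F \<in> vanishing_forms t" for c F
    using form_map_mult[OF forms_const that, of c] by (simp add: fun_eq_iff)
  show "form_map t (\<lambda>x. F x + G x) = (\<lambda>p. form_map t F p + form_map t G p)"
    if "F \<in> vanishing_forms t" "G \<in> vanishing_forms t" for F G
    by (rule ext) (rule form_map_add[OF that])
qed (rule vanishing_forms_add)

text \<open>Every point of \<open>C\<close> lies in some chart, where dividing by a power of the
  coordinate does not affect vanishing; the condition on \<phi> is then
  \<open>form_map_eq_0_iff\<close>.\<close>

lemma homog_ideal_kernel:
  "homog_ideal n (kernel_sheaf (ideal_sheaf n C) \<phi>) t =
     {F \<in> vanishing_forms t. form_map t F = (\<lambda>p. 0)}"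
proof -
  have "F \<in> homog_ideal n (kernel_sheaf (ideal_sheaf n C) \<phi>) t \<longleftrightarrow> F \<in> forms n t \<and>
      (\<forall>i\<le>n. dehomog n t F i \<in> sections (ideal_sheaf n C) (chart n i)) \<and>
      (\<forall>i\<le>n. \<phi> (chart n i) (dehomog n t F i) = 0)" for F
    unfolding homog_ideal_def kernel_sheaf_def by (auto simp: dehomog_def chart_def)
  moreover have "(\<forall>i\<le>n. dehomog n t F i \<in> sections (ideal_sheaf n C) (chart n i)) \<longleftrightarrow>
      F \<in> vanishing_forms t" if F: "F \<in> forms n t" for F
  proof
    assume *: "\<forall>i\<le>n. dehomog n t F i \<in> sections (ideal_sheaf n C) (chart n i)"
    have "F x = 0" if x: "x \<in> C" for x
    proof -
      have x': "x \<in> proj n"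
        using x curve_subset by blast
      then obtain i where "x i \<noteq> 0"
        by (auto simp: proj_def fun_eq_iff)
      moreover from this have i: "i \<le> n"
        using x' by (auto simp: proj_def vecs_def not_less[symmetric])
      ultimately have "dehomog n t F i x = 0"
        using * x x' unfolding ideal_sheaf_iff by (simp add: chart_def)
      then show ?thesis
        using \<open>x i \<noteq> 0\<close> x' by (simp add: dehomog_def chart_def)
    qed
    with F show "F \<in> vanishing_forms t"
      by (simp add: vanishing_forms_def)
  qed (simp add: dehomog_ideal)
  ultimately show ?thesis
    using form_map_eq_0_iff by (auto simp: vanishing_forms_def)
qed

lemma hilbert_function:
  "\<exists>t0. \<forall>t\<ge>t0. int (fn_dim (forms n t :: 'k fn set)) =
     int (fn_dim (homog_ideal n (kernel_sheaf (ideal_sheaf n C) \<phi>) t)) + 2 * int r * int t + m + 2"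
proof -
  obtain D where D: "\<And>d t. int d = m + int (r * t) \<Longrightarrow> D \<le> d \<Longrightarrow> image_module d = forms 1 d"
    by (rule image_module_large_degree) blast
  have "int (fn_dim (forms n t :: 'k fn set)) =
     int (fn_dim (homog_ideal n (kernel_sheaf (ideal_sheaf n C) \<phi>) t)) + 2 * int r * int t + m + 2"
    if t: "nat \<bar>m\<bar> + D \<le> t" for t
  proof -
    \<comment> \<open>With \<open>t\<close> at least \<open>D\<close> plus the absolute value of
      \<open>m\<close>, this gives \<open>m + r t\<close> at least \<open>D\<close>; in particular
      it is a natural number and the degree is large enough.\<close>
    have "t \<le> r * t"
      using degree_pos by simp
    then have d: "int (nat (m + int (r * t))) = m + int (r * t)" "D \<le> nat (m + int (r * t))"
      using t by linarith+
    show ?thesis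
      unfolding homog_ideal_kernel dim_vanishing_forms dim_form_map_kernel[OF d(1) D[OF d]]
      using d(1) by simp
  qed
  then show ?thesis
    by (intro exI[of _ "nat \<bar>m\<bar> + D"]) blast
qed

end

section \<open>The doubling\<close>

lemma line_bundle_sum_restrict:
  assumes "s \<in> sections (line_bundle_sum n ms) U" "zopen n V" "V \<subseteq> U"
  shows "restr (line_bundle_sum n ms) V s \<in> sections (line_bundle_sum n ms) V"
proof -
  have "cut V 0 = 0"
    by (simp add: cut_def fun_eq_iff)
  then show ?thesis
    using assms line_bundle_cut[OF _ assms(2,3)] by (simp add: line_bundle_sum_def)
qed

text \<open>Sections vanish off \<open>U\<close>, so only the values of the scalar on
  \<open>U\<close> count. This permits replacing \<open>a \<circ> j\<close> by its cut-off
  version.\<close>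

lemma line_bundle_sum_scal_cong:
  assumes "s \<in> sections (line_bundle_sum n ms) U" "\<And>x. x \<in> U \<Longrightarrow> a x = b x"
  shows "scal (line_bundle_sum n ms) a s = scal (line_bundle_sum n ms) b s"
proof -
  have "a x * s k x = b x * s k x" for k x
  proof (cases "x \<in> U")
    case False
    then have "s k x = 0"
      using assms(1) line_bundle_vanish[of "s k" n _ U x]
      by (cases "k < length ms") (auto simp: line_bundle_sum_def)
    then show ?thesis by simp
  qed (simp add: assms(2))
  then show ?thesis
    by (simp add: line_bundle_sum_def fun_eq_iff)
qed

lemma sheaf_homD:
  assumes "sheaf_hom n F G \<phi>" "zopen n U" "s \<in> sections F U"
  shows "\<phi> U s \<in> sections G U"
    and "t \<in> sections F U \<Longrightarrow> \<phi> U (s + t) = \<phi> U s + \<phi> U t"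
    and "a \<in> sections (line_bundle n 0) U \<Longrightarrow> \<phi> U (scal F a s) = scal G a (\<phi> U s)"
    and "zopen n V \<Longrightarrow> V \<subseteq> U \<Longrightarrow> \<phi> V (restr F V s) = restr G V (\<phi> U s)"
  using assms unfolding sheaf_hom_def by simp_all

lemma sheaf_surjD:
  assumes "sheaf_surj n F G \<phi>" "zopen n U" "t \<in> sections G U" "p \<in> U"
  obtains V s where "zopen n V" "p \<in> V" "V \<subseteq> U" "s \<in> sections F V" "\<phi> V s = restr G V t"
proof -
  have "\<exists>V. zopen n V \<and> p \<in> V \<and> V \<subseteq> U \<and> (\<exists>s\<in>sections F V. \<phi> V s = restr G V t)"
    using assms unfolding sheaf_surj_def by simp
  then show thesis
    by (elim exE conjE bexE) (rule that)
qed

text \<open>On a chart the \<open>m\<close>-th power of the coordinate generates O(m). Writing it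
  with exponents \<open>nat m\<close> and \<open>nat (- m)\<close>, one of which is 0, covers both
  signs.\<close>

lemma line_bundle_local_generator:
  assumes p: "p \<in> proj n"
  obtains U t where "zopen n U" "p \<in> U" "t \<in> sections (line_bundle n m) U" "t p \<noteq> 0"
proof -
  obtain i where "p i \<noteq> 0"
    using p by (auto simp: proj_def fun_eq_iff)
  moreover from this have i: "i \<le> n"
    using p by (auto simp: proj_def vecs_def not_less[symmetric])
  moreover define t :: "'a fn" where "t = cut (chart n i) (\<lambda>x. x i ^ nat m / x i ^ nat (- m))"
  have "t \<in> sections (line_bundle n m) (chart n i)"
    unfolding t_def
    by (rule line_bundle_quotient[OF forms_var_power[OF i] forms_var_power[OF i]])
      (simp_all add: zopen_chart[OF i], simp add: chart_def)
  ultimately show thesis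
    using p by (intro that[of "chart n i" t] zopen_chart) (simp_all add: t_def chart_def)
qed

text \<open>For nonvanishing at \<open>p\<close>, a local generator of O(m) is lifted through \<mu>
  and then through \<theta>. The first lift lives on an open set of the line, whereas \<theta> lifts
  over open sets of the ambient space, so \<open>basic_open_lift\<close> is needed in
  between.\<close>

lemma curve_ideal_map_doubling:
  fixes j :: "'k::{alg_closed_field, field_char_0} pt \<Rightarrow> 'k pt"
  assumes r: "1 \<le> r" and curve: "rational_normal_curve n r j C"
    and E: "E = line_bundle_sum 1 ms"
    and \<theta>: "conormal_iso n j C E \<theta>"
    and hom: "sheaf_hom 1 E (line_bundle 1 m) \<mu>" and surj: "sheaf_surj 1 E (line_bundle 1 m) \<mu>"
  shows "curve_ideal_map n r j C (\<lambda>U f. pushforward_map j \<mu> U (\<theta> U f)) m"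
proof -
  interpret rational_normal n r j C
    by unfold_locales (fact r curve)+
  have \<theta>_hom: "sheaf_hom n (ideal_sheaf n C) (pushforward j E) \<theta>"
    and \<theta>_surj: "sheaf_surj n (ideal_sheaf n C) (pushforward j E) \<theta>"
    using \<theta> by (simp_all add: conormal_iso_def)
  have ideal_simps: "scal (ideal_sheaf n C) = (*)" "restr (ideal_sheaf n C) = cut"
    by (simp_all add: ideal_sheaf_def)
  have push_simps: "sections (pushforward j E) U = sections E (preim j U)"
    "scal (pushforward j E) a s = scal E (a \<circ> j) s"
    "restr (pushforward j E) U s = restr E (preim j U) s" for U a s
    by (simp_all add: pushforward_def)
  note \<theta>D = sheaf_homD[OF \<theta>_hom, unfolded push_simps ideal_simps]
  note \<mu>D = sheaf_homD[OF hom, unfolded line_bundle_simps]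
  show ?thesis
  proof unfold_locales
    fix U :: "'k pt set" and f assume U: "zopen n U" and f: "f \<in> sections (ideal_sheaf n C) U"
    note s = \<theta>D(1)[OF U f]
    show "pushforward_map j \<mu> U (\<theta> U f) \<in> sections (line_bundle 1 m) (preim j U)"
      unfolding pushforward_map_def by (rule \<mu>D(1)[OF zopen_preim[OF U] s])
    show "pushforward_map j \<mu> U (\<theta> U (f + g)) =
        pushforward_map j \<mu> U (\<theta> U f) + pushforward_map j \<mu> U (\<theta> U g)"
      if g: "g \<in> sections (ideal_sheaf n C) U" for g
      unfolding pushforward_map_def \<theta>D(2)[OF U f g]
      by (rule \<mu>D(2)[OF zopen_preim[OF U] s \<theta>D(1)[OF U g]])
    show "pushforward_map j \<mu> U (\<theta> U (a * f)) p = a (j p) * pushforward_map j \<mu> U (\<theta> U f) p"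
      if a: "a \<in> sections (line_bundle n 0) U" and p: "p \<in> preim j U" for a p
    proof -
      have "scal E (a \<circ> j) (\<theta> U f) = scal E (cut (preim j U) (a \<circ> j)) (\<theta> U f)"
        using s unfolding E by (rule line_bundle_sum_scal_cong) simp
      then have "\<mu> (preim j U) (\<theta> U (a * f)) = cut (preim j U) (a \<circ> j) * \<mu> (preim j U) (\<theta> U f)"
        unfolding \<theta>D(3)[OF U f a]
        by (simp only: \<mu>D(3)[OF zopen_preim[OF U] s pullback_section[OF a]])
      then show ?thesis
        using p by (simp add: pushforward_map_def)
    qed
    show "pushforward_map j \<mu> V (\<theta> V (cut V f)) = cut (preim j V) (pushforward_map j \<mu> U (\<theta> U f))"
      if V: "zopen n V" "V \<subseteq> U" for V
      unfolding pushforward_map_def \<theta>D(4)[OF U f V]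
      by (rule \<mu>D(4)[OF zopen_preim[OF U] s zopen_preim[OF V(1)] preim_subset[OF V(2)]])
  next
    fix p :: "'k pt" assume p: "p \<in> proj 1"
    obtain U t where U: "zopen 1 U" "p \<in> U" "t \<in> sections (line_bundle 1 m) U" "t p \<noteq> 0"
      using p by (rule line_bundle_local_generator)
    obtain V s where V: "zopen 1 V" "p \<in> V" "V \<subseteq> U" and s: "s \<in> sections E V"
      and \<mu>s: "\<mu> V s = restr (line_bundle 1 m) V t"
      using surj U(1,3,2) by (rule sheaf_surjD)
    obtain e Q where Q: "Q \<in> forms 1 e" "p \<in> basic_open 1 Q" "basic_open 1 Q \<subseteq> V"
      using V(1,2) by (rule zopen_basicE)
    obtain G where G: "G \<in> forms n e" "preim j (basic_open n G) = basic_open 1 Q"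
      using Q(1) by (rule basic_open_lift)
    define s' where "s' = restr E (basic_open 1 Q) s"
    have s': "s' \<in> sections E (basic_open 1 Q)"
      using s zopen_basic_open[OF Q(1)] Q(3) unfolding s'_def E by (rule line_bundle_sum_restrict)
    have s'_push: "s' \<in> sections (pushforward j E) (basic_open n G)"
      unfolding push_simps G(2) by (rule s')
    have jp: "j p \<in> basic_open n G"
      using Q(2) unfolding G(2)[symmetric] by (simp add: preim_def)
    obtain W f where W: "zopen n W" "j p \<in> W" "W \<subseteq> basic_open n G"
      and f: "f \<in> sections (ideal_sheaf n C) W" and \<theta>f: "\<theta> W f = restr (pushforward j E) W s'"
      using \<theta>_surj zopen_basic_open[OF G(1)] s'_push jp
      by (rule sheaf_surjD)
    have W': "preim j W \<subseteq> basic_open 1 Q" "p \<in> preim j W"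
      using preim_subset[OF W(3)] p W(2) unfolding G(2) by (simp_all add: preim_def)
    have "\<mu> (preim j W) (\<theta> W f) = cut (preim j W) (\<mu> (basic_open 1 Q) s')"
      unfolding \<theta>f push_simps
      by (rule \<mu>D(4)[OF zopen_basic_open[OF Q(1)] s' zopen_preim[OF W(1)] W'(1)])
    also have "\<mu> (basic_open 1 Q) s' = cut (basic_open 1 Q) (\<mu> V s)"
      unfolding s'_def by (rule \<mu>D(4)[OF V(1) s zopen_basic_open[OF Q(1)] Q(3)])
    finally have "\<mu> (preim j W) (\<theta> W f) p = t p"
      unfolding \<mu>s using W'(2) Q(2) V(2) by simp
    then show "\<exists>V f. zopen n V \<and> j p \<in> V \<and> f \<in> sections (ideal_sheaf n C) V \<and>
        pushforward_map j \<mu> V (\<theta> V f) p \<noteq> 0"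
      using W f U(4) by (intro exI[of _ W] exI[of _ f]) (simp add: pushforward_map_def)
  qed
qed

text \<open>The difference of two candidates has all large integers as roots. This makes the
  definite description in \<open>arithmetic_genus\<close> well determined.\<close>

lemma has_hilbert_polynomial_unique:
  assumes "has_hilbert_polynomial n I P" "has_hilbert_polynomial n I Q"
  shows "P = Q"
proof (rule ccontr)
  assume "P \<noteq> Q"
  obtain t0 where t0: "\<forall>t\<ge>t0. of_nat (fn_dim (forms n t :: 'a fn set)) -
      of_nat (fn_dim (homog_ideal n I t)) = poly P (of_nat t)"
    using assms(1) unfolding has_hilbert_polynomial_def by (elim exE)
  obtain t1 where t1: "\<forall>t\<ge>t1. of_nat (fn_dim (forms n t :: 'a fn set)) -
      of_nat (fn_dim (homog_ideal n I t)) = poly Q (of_nat t)"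
    using assms(2) unfolding has_hilbert_polynomial_def by (elim exE)
  have "poly (P - Q) (of_nat t) = 0" if "max t0 t1 \<le> t" for t
    using t0[rule_format, of t] t1[rule_format, of t] that by simp
  then have "of_nat ` {max t0 t1..} \<subseteq> {x. poly (P - Q) x = 0}"
    by auto
  then have "finite (of_nat ` {max t0 t1..} :: rat set)"
    using poly_roots_finite[of "P - Q"] \<open>P \<noteq> Q\<close> by (auto intro: finite_subset)
  then show False
    by (simp add: finite_image_iff inj_on_def infinite_Ici)
qed

theorem proposition2p11:
  fixes n r a :: nat
    and j :: "'k::{alg_closed_field, field_char_0} pt \<Rightarrow> 'k pt"
    and C :: "'k pt set"
    and E :: "('k, nat \<Rightarrow> 'k fn) sheaf"
    and \<theta> :: "'k pt set \<Rightarrow> 'k fn \<Rightarrow> nat \<Rightarrow> 'k fn"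
    and \<mu> :: "'k pt set \<Rightarrow> (nat \<Rightarrow> 'k fn) \<Rightarrow> 'k fn"
    and X :: "('k, 'k fn) sheaf"
  assumes "1 \<le> r" and "r \<le> n"
    and "rational_normal_curve n r j C"
    and "E = line_bundle_sum 1 (replicate (r - 1) (- int r - 2) @ replicate (n - r) (- int r))"
    and "conormal_iso n j C E \<theta>"
    and "sheaf_hom 1 E (line_bundle 1 (- int r - 2 + int a)) \<mu>"
    and "sheaf_surj 1 E (line_bundle 1 (- int r - 2 + int a)) \<mu>"
    and "X = doubling n j C \<theta> \<mu>"
  shows "has_hilbert_polynomial n X [:of_int (int a - int r), of_nat (2 * r):]
       \<and> arithmetic_genus n X = int r + 1 - int a"
proof
  interpret curve_ideal_map n r j C "\<lambda>U f. pushforward_map j \<mu> U (\<theta> U f)" "- int r - 2 + int a"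
    using assms(1,3-7) by (rule curve_ideal_map_doubling)
  obtain t0 where t0: "\<forall>t\<ge>t0. int (fn_dim (forms n t :: 'k fn set)) =
      int (fn_dim (homog_ideal n X t)) + 2 * int r * int t + (- int r - 2 + int a) + 2"
    using hilbert_function unfolding assms(8) doubling_def by (elim exE)
  show hp: "has_hilbert_polynomial n X [:of_int (int a - int r), of_nat (2 * r):]"
    unfolding has_hilbert_polynomial_def
  proof (intro exI allI impI)
    fix t assume "t0 \<le> t"
    \<comment> \<open>The constant \<open>m + 2\<close> turns into \<open>a - r\<close>; the
      identity is first proved over the integers and then transported to the rationals.\<close>
    with t0 have "int (fn_dim (forms n t :: 'k fn set)) - int (fn_dim (homog_ideal n X t)) =
        (int a - int r) + int t * (2 * int r)"
      by simp
    from arg_cong[OF this, of "of_int :: int \<Rightarrow> rat"]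
    show "of_nat (fn_dim (forms n t :: 'k fn set)) - of_nat (fn_dim (homog_ideal n X t)) =
        poly [:of_int (int a - int r), of_nat (2 * r):] (of_nat t :: rat)"
      by simp
  qed
  show "arithmetic_genus n X = int r + 1 - int a"
    unfolding arithmetic_genus_def
  proof (rule the_equality)
    show "\<exists>d::nat. has_hilbert_polynomial n X [:1 - of_int (int r + 1 - int a), of_nat d:]"
      using hp by (intro exI[of _ "2 * r"]) simp
    fix g assume "\<exists>d::nat. has_hilbert_polynomial n X [:1 - of_int g, of_nat d:]"
    then obtain d :: nat where "has_hilbert_polynomial n X [:1 - of_int g, of_nat d:]"
      by (elim exE)
    \<comment> \<open>Equal polynomials have equal constant terms, which determines \<open>g\<close>
      whatever the degree \<open>d\<close> is.\<close>
    from has_hilbert_polynomial_unique[OF this hp]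
    have "of_int (1 - g) = (of_int (int a - int r) :: rat)"
      by simp
    then show "g = int r + 1 - int a"
      unfolding of_int_eq_iff by linarith
  qed
qed

end
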